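(* Let $\{X_k\}$ be the sequence generated by the adaptive accelerated proximal gradient (APG) algorithm (described in the context) applied to the problem $\min_{X\in\mathcal S^N} h(X)$, and let $\mathcal X_\star$ be the set of global minimizers of $h$. Suppose that: (i) writing $K_m=\hat K_m\hat K_m^{H}$ with $\hat K_m\in\mathbb C^{N\times N}$ for $m=1,\dots,M$, the matrix $A=(\hat K_1,\dots,\hat K_M)^{H}\in\mathbb C^{MN\times N}$ has full column rank; (ii) $\mathcal X_\star\neq\emptyset$, and there exists $X_\star\in\mathcal X_\star$ with $0\in\nabla f(X_\star)+\mathrm{ri}\big(\mathcal N_{\mathcal S^N_+}(X_\star)\big)$, where $\mathcal N_{\mathcal S^N_+}(X)$ is the normal cone of $\mathcal S^N_+$ at $X$ (in $\mathcal S^N$) and $\mathrm{ri}$ denotes the relative interior. Then there exists $\bar X\in\mathcal X_\star$ such that one of the following holds: 1. $\{X_k\}$ converges to $\bar X$ in finitely many steps (i.e. $X_k=\bar X$ for all sufficiently large $k$); 2. $\{h(X_k)\}$ and $\{X_k\}$ converge linearly to $h(\bar X)$ and $\bar X$ respectively, i.e. there exist $c_1,c_2>0$, $w_1,w_2\in(0,1)$ and $k_\ell>0$ such that $$h(X_k)-h(\bar X)\le c_1w_1^k\quad\text{and}\quad \|X_k-\bar X\|_F\le c_2w_2^k\qquad\text{for all }k>k_\ell.$$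
   Context: Problem. $\mathcal S^N$ is the real vector space of $N\times N$ Hermitian matrices with inner product $\langle A,B\rangle=\mathrm{tr}(A^{H}B)$ and Frobenius norm $\|\cdot\|_F$; $\mathcal S^N_+\subset\mathcal S^N$ is the set of positive semidefinite matrices. Given are $K_1,\dots,K_M\in\mathcal S^N_+$, $\sigma_1,\dots,\sigma_M>0$, $y_1,\dots,y_M\in\mathbb R$, $R\in\mathcal S^N_+$ and $\mu>0$. Define $\mathscr A:\mathcal S^N\to\mathbb R^M$ by $\mathscr A(X)[m]=\mathrm{tr}(K_m^{H}X)/\sigma_m$, with adjoint $\mathscr A^{H}$, and $b\in\mathbb R^M$ by $b[m]=y_m/\sigma_m$. Set $f(X)=\tfrac12\|\mathscr A(X)-b\|_2^2+\mu\langle R,X\rangle$, $g=\iota_{\mathcal S^N_+}$ (value $0$ on $\mathcal S^N_+$, $+\infty$ elsewhere), $h=f+g$. Then $\nabla f(X)=\mathscr A^{H}(\mathscr A(X)-b)+\mu R$. Let $L$ be the largest eigenvalue of $\mathscr A^{H}\mathscr A$. For $\alpha>0$, $\mathrm{Prox}_g^{\alpha}(X)=\arg\min_Y\{g(Y)+\tfrac1{2\alpha}\|Y-X\|_F^2\}$, which is the projection of $X$ onto $\mathcal S^N_+$. Adaptive APG algorithm. Constants: $\gamma,\delta>0$, $\rho\in(0,1)$, $0<\alpha_{\min}\le\alpha_{\max}$, $k_{\rm maxres}\in\mathbb N$, and $X_0\in\mathcal S^N_+$. Given $X_k,Y_k$, a step size $\alpha_k$ and $Z_{k+1}=\mathrm{Prox}_g^{\alpha_k}(Y_k-\alpha_k\nabla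 f(Y_k))$, put $U_k=Y_k-Z_{k+1}$, $V_k=X_k-Z_{k+1}$ and consider the conditions (A) $\langle U_k,V_k\rangle-\alpha_k\langle\mathscr A(U_k),\mathscr A(V_k)\rangle\ge\gamma\|V_k\|_F^2$; (B) $h(Y_k)-h(Z_{k+1})\ge\delta\|Y_k-Z_{k+1}\|_F^2$. Initialize $X_1=Y_1=Y_0=X_0$, $t_1=1$, $k=1$, $k_{\rm res}=0$. Repeat indefinitely: 1. Compute $\alpha_k$ by the step-size procedure below and set $Z_{k+1}=\mathrm{Prox}_g^{\alpha_k}(Y_k-\alpha_k\nabla f(Y_k))$. 2. If [$X_k=Y_k$ or (A) holds] and $k-k_{\rm res}\le k_{\rm maxres}$: set $X_{k+1}=Z_{k+1}$, $t_{k+1}=\tfrac12(\sqrt{4t_k^2+1}+1)$, $Y_{k+1}=X_{k+1}+\frac{t_k-1}{t_{k+1}}(X_{k+1}-X_k)$, and replace $k$ by $k+1$. 3. Otherwise (restart): set $t_k=1$, $k_{\rm res}=k$, $Y_k=X_k$ (with $k$ unchanged) and go back to step 1. Step-size procedure. If $k=1$ initialize $\beta=\|b-\mathscr A(Y_k)\|_2^2/\|\mathscr A^{H}(b-\mathscr A(Y_k))\|_F^2$; otherwise, with $S_k=Y_k-Y_{k-1}$ and $T_k=\nabla f(Y_k)-\nabla f(Y_{k-1})$, initialize $\beta=|\langle S_k,T_k\rangle|/\|T_k\|_F^2$ (if the denominator vanishes, $\beta$ is initialized to an arbitrary positive number). Then repeatedly compute $Z_{k+1}=\mathrm{Prox}_g^{\beta}(Y_k-\beta\nabla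 f(Y_k))$ and stop if [$X_k\ne Y_k$ and (A) fails with $\alpha_k=\beta$] or (B) holds or $\beta<\alpha_{\min}$; otherwise replace $\beta$ by $\rho\beta$. Finally $\alpha_k=\min\{\max(\alpha_{\min},\beta),\alpha_{\max}\}$. Standing convention: the constants are such that whenever $Y_k=X_k$, the accepted step size $\alpha_k$ (with its $Z_{k+1}$) satisfies (B). (Inequality (B) is automatic when $Y_k\in\mathcal S^N_+$ and $\alpha_k\le 1/(L+\delta)$.) *)

theory Defs
  imports "HOL-Analysis.Analysis"
begin

section \<open>Hermitian matrices\<close>

definition ctranspose :: "complex^'n^'m \<Rightarrow> complex^'m^'n" where
  "ctranspose A = (\<chi> i j. cnj (A $ j $ i))"

text \<open>
  The space \<open>\<S>\<^sup>N\<close> is the real subspace \<open>herm_mats\<close> of \<^typ>\<open>complex^'n^'n\<close>, with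
  \<open>N = CARD('n)\<close>.  The inner product and the norm are the ones of \<^typ>\<open>complex^'n^'n\<close> as a
  Euclidean space; by \<open>inner_eq_trace\<close>, \<open>norm_eq_trace\<close> and \<open>trace_herm_real\<close> below they
  are the trace inner product and the Frobenius norm.
\<close>

definition herm_mats :: "(complex^'n^'n) set" where
  "herm_mats = {A. ctranspose A = A}"

definition psd_mats :: "(complex^'n^'n) set" where
  "psd_mats = {A \<in> herm_mats. \<forall>x. 0 \<le> Re (\<Sum>i\<in>UNIV. cnj (x $ i) * (A *v x) $ i)}"

lemma trace_ctranspose_mult:
  "trace (ctranspose A ** B) = (\<Sum>i\<in>UNIV. \<Sum>j\<in>UNIV. cnj (A $ i $ j) * B $ i $ j)"
  for A B :: "complex^'n^'n"
  unfolding trace_def matrix_matrix_mult_def ctranspose_def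
  by (simp, rule sum.swap)

lemma inner_eq_trace: "A \<bullet> B = Re (trace (ctranspose A ** B))"
  for A B :: "complex^'n^'n"
  unfolding trace_ctranspose_mult by (simp add: inner_vec_def inner_complex_def)

lemma trace_herm_real:
  fixes A B :: "complex^'n^'n"
  assumes "A \<in> herm_mats" "B \<in> herm_mats"
  shows "trace (ctranspose A ** B) = of_real (A \<bullet> B)"
proof -
  have a: "cnj (A $ i $ j) = A $ j $ i" for i j
    using assms(1) unfolding herm_mats_def ctranspose_def by (auto simp: vec_eq_iff)
  have b: "cnj (B $ i $ j) = B $ j $ i" for i j
    using assms(2) unfolding herm_mats_def ctranspose_def by (auto simp: vec_eq_iff)
  have "cnj (trace (ctranspose A ** B)) = (\<Sum>i\<in>UNIV. \<Sum>j\<in>UNIV. A $ i $ j * B $ j $ i)"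
    unfolding trace_ctranspose_mult by (simp add: b)
  also have "\<dots> = trace (ctranspose A ** B)"
    unfolding trace_ctranspose_mult a by (rule sum.swap)
  finally show ?thesis
    unfolding inner_eq_trace by (metis Reals_cnj_iff of_real_Re)
qed

lemma norm_eq_trace: "norm A = sqrt (Re (trace (ctranspose A ** A)))"
  for A :: "complex^'n^'n"
  by (simp add: norm_eq_sqrt_inner inner_eq_trace)


section \<open>The optimization problem\<close>

text \<open>The number \<open>M\<close> of measurements is \<open>CARD('m)\<close>.\<close>

record ('n, 'm) sdp_problem =
  Kmat :: "'m \<Rightarrow> complex^'n^'n"
  sigma :: "'m \<Rightarrow> real"
  yobs :: "'m \<Rightarrow> real"
  Rmat :: "complex^'n^'n"
  mu :: real

definition valid_problem :: "('n::finite, 'm::finite) sdp_problem \<Rightarrow> bool" where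
  "valid_problem P \<longleftrightarrow>
     (\<forall>m. Kmat P m \<in> psd_mats) \<and> (\<forall>m. 0 < sigma P m) \<and> Rmat P \<in> psd_mats \<and> 0 < mu P"

text \<open>
  For Hermitian \<open>X\<close> the trace is real, so \<open>Re\<close> changes nothing there.  It makes \<open>meas\<close>
  real linear on all of \<^typ>\<open>complex^'n^'n\<close>; its library adjoint takes values in
  \<open>herm_mats\<close> (\<open>adjoint_meas\<close>, \<open>adjoint_meas_herm\<close>) and hence is also the adjoint of the
  restriction of \<open>meas\<close> to \<open>herm_mats\<close>.
\<close>

definition meas :: "('n::finite, 'm::finite) sdp_problem \<Rightarrow> complex^'n^'n \<Rightarrow> real^'m" where
  "meas P X = (\<chi> m. Re (trace (ctranspose (Kmat P m) ** X)) / sigma P m)"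

abbreviation meas_adj :: "('n::finite, 'm::finite) sdp_problem \<Rightarrow> real^'m \<Rightarrow> complex^'n^'n" where
  "meas_adj P \<equiv> adjoint (meas P)"

definition bvec :: "('n::finite, 'm::finite) sdp_problem \<Rightarrow> real^'m" where
  "bvec P = (\<chi> m. yobs P m / sigma P m)"

definition ffun :: "('n::finite, 'm::finite) sdp_problem \<Rightarrow> complex^'n^'n \<Rightarrow> real" where
  "ffun P X = 1 / 2 * (norm (meas P X - bvec P))\<^sup>2 + mu P * (Rmat P \<bullet> X)"

definition grad_f :: "('n::finite, 'm::finite) sdp_problem \<Rightarrow> complex^'n^'n \<Rightarrow> complex^'n^'n" where
  "grad_f P X = meas_adj P (meas P X - bvec P) + mu P *\<^sub>R Rmat P"

definition gfun :: "complex^'n^'n \<Rightarrow> ereal" where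
  "gfun X = (if X \<in> psd_mats then 0 else \<infinity>)"

definition hfun :: "('n::finite, 'm::finite) sdp_problem \<Rightarrow> complex^'n^'n \<Rightarrow> ereal" where
  "hfun P X = ereal (ffun P X) + gfun X"

definition minimizers :: "('n::finite, 'm::finite) sdp_problem \<Rightarrow> (complex^'n^'n) set" where
  "minimizers P = {X. is_arg_min (hfun P) (\<lambda>Y. Y \<in> herm_mats) X}"

definition prox_g :: "real \<Rightarrow> complex^'n^'n \<Rightarrow> complex^'n^'n" where
  "prox_g \<alpha> X =
     arg_min (\<lambda>Y. gfun Y + ereal (1 / (2 * \<alpha>) * (norm (Y - X))\<^sup>2)) (\<lambda>Y. Y \<in> herm_mats)"

definition normal_cone_psd :: "complex^'n^'n \<Rightarrow> (complex^'n^'n) set" where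
  "normal_cone_psd X =
     (if X \<in> psd_mats then {G \<in> herm_mats. \<forall>Y\<in>psd_mats. G \<bullet> (Y - X) \<le> 0} else {})"

text \<open>The \<open>MN \<times> N\<close> matrix \<open>(K\<^sub>1, \<dots>, K\<^sub>M)\<^sup>H\<close>, its rows indexed by pairs (block, row in block).\<close>

definition stack_ct :: "('m::finite \<Rightarrow> complex^'n^'n) \<Rightarrow> complex^'n^('m \<times> 'n)" where
  "stack_ct K = (\<chi> p j. ctranspose (K (fst p)) $ snd p $ j)"

lemma meas_eq_inner: "meas P X = (\<chi> m. (Kmat P m \<bullet> X) / sigma P m)"
  unfolding meas_def inner_eq_trace ..

lemma linear_meas: "linear (meas P)"
  by (rule linearI)
    (auto simp: meas_eq_inner vec_eq_iff inner_add_right add_divide_distrib)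

lemma adjoint_meas:
  fixes P :: "('n::finite, 'm::finite) sdp_problem"
  shows
  "meas_adj P v = (\<Sum>m\<in>UNIV. (v $ m / sigma P m) *\<^sub>R Kmat P m)"
proof -
  have "meas_adj P = (\<lambda>v. \<Sum>m\<in>UNIV. (v $ m / sigma P m) *\<^sub>R Kmat P m)"
  proof (rule adjoint_unique, intro allI)
    fix X :: "complex^'n^'n" and v :: "real^'m"
    have "meas P X \<bullet> v = (\<Sum>m\<in>UNIV. (Kmat P m \<bullet> X) / sigma P m * v $ m)"
      by (simp add: meas_eq_inner inner_vec_def[where 'a = real])
    also have "\<dots> = X \<bullet> (\<Sum>m\<in>UNIV. (v $ m / sigma P m) *\<^sub>R Kmat P m)"
      by (simp add: inner_sum_right inner_commute mult.commute)
    finally show "meas P X \<bullet> v = X \<bullet> (\<Sum>m\<in>UNIV. (v $ m / sigma P m) *\<^sub>R Kmat P m)" .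
  qed
  then show ?thesis by simp
qed

lemma adjoint_meas_herm:
  assumes "valid_problem P"
  shows "meas_adj P v \<in> herm_mats"
  using assms unfolding valid_problem_def psd_mats_def
  by (auto simp: adjoint_meas herm_mats_def ctranspose_def vec_eq_iff)

lemma GDERIV_ffun: "GDERIV (ffun P) X :> grad_f P X"
proof -
  have d: "(meas P has_derivative meas P) (at X)"
    by (simp add: linear_meas linear_conv_bounded_linear[symmetric] bounded_linear_imp_has_derivative)
  have "(ffun P has_derivative (\<lambda>H. H \<bullet> grad_f P X)) (at X)"
    unfolding ffun_def[abs_def] power2_norm_eq_inner
    by (rule has_derivative_eq_rhs, (rule derivative_intros d)+)
      (auto simp: fun_eq_iff grad_f_def inner_add_right adjoint_works[OF linear_meas] inner_commute)
  then show ?thesis unfolding gderiv_def .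
qed


section \<open>The adaptive APG algorithm\<close>

record apg_params =
  gam :: real
  del :: real
  rho :: real
  amin :: real
  amax :: real
  kmaxres :: nat

definition valid_params :: "apg_params \<Rightarrow> bool" where
  "valid_params C \<longleftrightarrow>
     0 < gam C \<and> 0 < del C \<and> 0 < rho C \<and> rho C < 1 \<and> 0 < amin C \<and> amin C \<le> amax C"

text \<open>
  The program variables on entry to step 1: \<open>k\<close>, \<open>k\<^sub>r\<^sub>e\<^sub>s\<close>, \<open>X\<^sub>k\<close>, \<open>Y\<^sub>k\<close>, \<open>Y\<^sub>k\<^sub>-\<^sub>1\<close>, \<open>t\<^sub>k\<close>.
\<close>

record 'n apg_state =
  cnt :: nat
  kres :: nat
  curX :: "complex^'n^'n"
  curY :: "complex^'n^'n"
  prevY :: "complex^'n^'n"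
  tmom :: real

definition init_state :: "complex^'n^'n \<Rightarrow> 'n::finite apg_state" where
  "init_state X0 = \<lparr>cnt = 1, kres = 0, curX = X0, curY = X0, prevY = X0, tmom = 1\<rparr>"

definition prox_step ::
  "('n::finite, 'm::finite) sdp_problem \<Rightarrow> complex^'n^'n \<Rightarrow> real \<Rightarrow> complex^'n^'n" where
  "prox_step P Y \<alpha> = prox_g \<alpha> (Y - \<alpha> *\<^sub>R grad_f P Y)"

definition condA ::
  "('n::finite, 'm::finite) sdp_problem \<Rightarrow> apg_params \<Rightarrow> 'n apg_state \<Rightarrow> real \<Rightarrow> bool" where
  "condA P C s \<alpha> \<longleftrightarrow>
     (let Z = prox_step P (curY s) \<alpha>; U = curY s - Z; V = curX s - Z
      in U \<bullet> V - \<alpha> * (meas P U \<bullet> meas P V) \<ge> gam C * (norm V)\<^sup>2)"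

text \<open>\<open>curY s\<close> need not be positive semidefinite; if it is not, then \<open>hfun P (curY s) = \<infinity>\<close>
  and \<open>condB\<close> holds.\<close>

definition condB ::
  "('n::finite, 'm::finite) sdp_problem \<Rightarrow> apg_params \<Rightarrow> 'n apg_state \<Rightarrow> real \<Rightarrow> bool" where
  "condB P C s \<alpha> \<longleftrightarrow>
     (let Z = prox_step P (curY s) \<alpha>
      in hfun P (curY s) - hfun P Z \<ge> ereal (del C * (norm (curY s - Z))\<^sup>2))"

text \<open>The admissible initial trial steps: any positive number if the denominator vanishes.\<close>

definition init_beta ::
  "('n::finite, 'm::finite) sdp_problem \<Rightarrow> 'n apg_state \<Rightarrow> real \<Rightarrow> bool" where
  "init_beta P s \<beta> \<longleftrightarrow>
     (let r = bvec P - meas P (curY s);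
          S = curY s - prevY s;
          T = grad_f P (curY s) - grad_f P (prevY s);
          num = (if cnt s = 1 then (norm r)\<^sup>2 else \<bar>S \<bullet> T\<bar>);
          den = (if cnt s = 1 then (norm (meas_adj P r))\<^sup>2 else (norm T)\<^sup>2)
      in if den = 0 then 0 < \<beta> else \<beta> = num / den)"

definition stop_search ::
  "('n::finite, 'm::finite) sdp_problem \<Rightarrow> apg_params \<Rightarrow> 'n apg_state \<Rightarrow> real \<Rightarrow> bool" where
  "stop_search P C s \<beta> \<longleftrightarrow>
     (curX s \<noteq> curY s \<and> \<not> condA P C s \<beta>) \<or> condB P C s \<beta> \<or> \<beta> < amin C"

text \<open>\<open>\<alpha>\<close> is a possible output of the step-size procedure started in state \<open>s\<close>; \<open>n\<close> is the number
  of reductions of the trial step.\<close>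

definition step_size ::
  "('n::finite, 'm::finite) sdp_problem \<Rightarrow> apg_params \<Rightarrow> 'n apg_state \<Rightarrow> real \<Rightarrow> bool" where
  "step_size P C s \<alpha> \<longleftrightarrow>
     (\<exists>\<beta>0 n. init_beta P s \<beta>0 \<and>
        (\<forall>i<n. \<not> stop_search P C s (rho C ^ i * \<beta>0)) \<and>
        stop_search P C s (rho C ^ n * \<beta>0) \<and>
        \<alpha> = min (max (amin C) (rho C ^ n * \<beta>0)) (amax C))"

definition accepts ::
  "('n::finite, 'm::finite) sdp_problem \<Rightarrow> apg_params \<Rightarrow> 'n apg_state \<Rightarrow> real \<Rightarrow> bool" where
  "accepts P C s \<alpha> \<longleftrightarrow> (curX s = curY s \<or> condA P C s \<alpha>) \<and> cnt s - kres s \<le> kmaxres C"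

definition advance ::
  "('n::finite, 'm::finite) sdp_problem \<Rightarrow> 'n apg_state \<Rightarrow> real \<Rightarrow> 'n apg_state" where
  "advance P s \<alpha> =
     (let X' = prox_step P (curY s) \<alpha>;
          t' = (sqrt (4 * (tmom s)\<^sup>2 + 1) + 1) / 2
      in \<lparr>cnt = cnt s + 1, kres = kres s, curX = X',
          curY = X' + ((tmom s - 1) / t') *\<^sub>R (X' - curX s),
          prevY = curY s, tmom = t'\<rparr>)"

definition restart :: "'n::finite apg_state \<Rightarrow> 'n apg_state" where
  "restart s = s\<lparr>tmom := 1, kres := cnt s, curY := curX s\<rparr>"

text \<open>
  An execution: \<open>s j\<close> is the state before the \<open>j\<close>-th pass through step 1 (counted from \<open>0\<close>,
  restarts included) and \<open>\<alpha> j\<close> is the step size computed in that pass.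
\<close>

definition apg_run ::
  "('n::finite, 'm::finite) sdp_problem \<Rightarrow> apg_params \<Rightarrow> complex^'n^'n \<Rightarrow>
   (nat \<Rightarrow> 'n apg_state) \<Rightarrow> (nat \<Rightarrow> real) \<Rightarrow> bool" where
  "apg_run P C X0 s \<alpha> \<longleftrightarrow>
     s 0 = init_state X0 \<and>
     (\<forall>j. step_size P C (s j) (\<alpha> j) \<and>
          s (Suc j) = (if accepts P C (s j) (\<alpha> j) then advance P (s j) (\<alpha> j) else restart (s j)))"

text \<open>
  The iterates \<open>X\<^sub>k\<close> of an execution.  A restart changes neither \<open>cnt\<close> nor \<open>curX\<close>, so all
  states with the same counter carry the same \<open>X\<^sub>k\<close>.
\<close>

definition apg_iterates ::
  "complex^'n^'n \<Rightarrow> (nat \<Rightarrow> 'n::finite apg_state) \<Rightarrow> (nat \<Rightarrow> complex^'n^'n) \<Rightarrow> bool" where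
  "apg_iterates X0 s X \<longleftrightarrow> X 0 = X0 \<and> (\<forall>j. X (cnt (s j)) = curX (s j))"

text \<open>
  The convention that the constants of the algorithm make \<open>(B)\<close> hold whenever \<open>Y\<^sub>k = X\<^sub>k\<close>,
  stated for the given execution: it concerns the step sizes with which step 2 produces
  \<open>X\<^sub>k\<^sub>+\<^sub>1\<close>, after the clipping to \<open>[\<alpha>\<^sub>m\<^sub>i\<^sub>n, \<alpha>\<^sub>m\<^sub>a\<^sub>x]\<close>.
\<close>

definition accepted_steps_decrease ::
  "('n::finite, 'm::finite) sdp_problem \<Rightarrow> apg_params \<Rightarrow>
   (nat \<Rightarrow> 'n apg_state) \<Rightarrow> (nat \<Rightarrow> real) \<Rightarrow> bool" where
  "accepted_steps_decrease P C s \<alpha> \<longleftrightarrow>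
     (\<forall>j. curY (s j) = curX (s j) \<and> accepts P C (s j) (\<alpha> j) \<longrightarrow> condB P C (s j) (\<alpha> j))"

end

theory Submission
  imports Defs
begin

text \<open>
  Every accepted step decreases \<open>h\<close> by a multiple of \<open>\<parallel>X\<^sub>k - X\<^sub>k\<^sub>+\<^sub>1\<parallel>\<^sup>2\<close>: by condition (B) right after a restart,
  and otherwise by condition (A), convexity of \<open>f\<close> and the obtuse angle property of the
  projection.  With \<open>S = \<nabla>f(X\<^sub>\<star>)\<close> the gap \<open>h(X) - h(X\<^sub>\<star>)\<close> equals
  \<open>\<parallel>\<A>(X - X\<^sub>\<star>)\<parallel>\<^sup>2/2 + \<langle>S, X\<rangle>\<close>; full column rank makes its sublevel sets bounded, and strict
  complementarity turns it into quadratic growth away from the solution set.  Quadratic growth makes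
  the proximal gradient step following a restart contract the gap by a fixed factor.  As restarts
  recur within a bounded number of iterations, the gap decays geometrically, hence so do the step
  lengths, and the iterates converge linearly.
\<close>

section \<open>Rank-one matrices and the positive semidefinite cone\<close>

definition outer :: "complex^'n \<Rightarrow> complex^'n \<Rightarrow> complex^'n^'n" where
  "outer u v = (\<chi> i j. u $ i * cnj (v $ j))"

lemma inner_complex_Re: "x \<bullet> y = Re (cnj x * y)"
  by (simp add: inner_complex_def)

text \<open>The real inner product of complex vectors is the real part of the Hermitian one. Pairing
  with a rank-one matrix thus makes the quadratic form at a vector a linear functional of
  \<open>A\<close>.\<close>

lemma inner_outer: "A \<bullet> outer u v = u \<bullet> (A *v v)"
proof -
  have "A $ i $ j \<bullet> (u $ i * cnj (v $ j)) = u $ i \<bullet> (A $ i $ j * v $ j)" for i j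
    by (simp add: inner_complex_def algebra_simps)
  then show ?thesis
    by (simp add: inner_vec_def[of A] inner_vec_def[of "A $ i" for i] inner_vec_def[of u]
        outer_def matrix_vector_mult_def inner_sum_right)
qed

lemma outer_mult_vec: "(outer u v *v x) $ i = u $ i * (\<Sum>j\<in>UNIV. cnj (v $ j) * x $ j)"
  by (simp add: outer_def matrix_vector_mult_def sum_distrib_left mult.assoc)

lemma norm_outer: "norm (outer u v) = norm u * norm v"
proof -
  have "outer u v $ i = (u $ i) *s (\<chi> j. cnj (v $ j))" for i
    by (simp add: outer_def vec_eq_iff)
  moreover have "norm (a *s (w :: complex^'n)) = cmod a * norm w" for a w
    by (simp add: norm_vec_def norm_mult L2_set_right_distrib)
  moreover have "norm (\<chi> j. cnj (v $ j)) = norm v"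
    by (simp add: norm_vec_def)
  ultimately have row: "norm (outer u v $ i) = norm (u $ i) * norm v" for i
    by metis
  show ?thesis
    unfolding norm_vec_def[of "outer u v"] row norm_vec_def[of u]
    by (simp add: L2_set_left_distrib)
qed

lemma outer_add_left: "outer (u + v) w = outer u w + outer v w"
  by (simp add: outer_def vec_eq_iff algebra_simps)

lemma outer_add_right: "outer w (u + v) = outer w u + outer w v"
  by (simp add: outer_def vec_eq_iff algebra_simps)

section \<open>Hermitian matrices and elementary properties of the semidefinite cone\<close>

lemma herm_cnj: "A \<in> herm_mats \<Longrightarrow> cnj (A $ i $ j) = A $ j $ i"
  by (auto simp: herm_mats_def ctranspose_def vec_eq_iff)

lemma herm_matsI: "(\<And>i j. cnj (A $ i $ j) = A $ j $ i) \<Longrightarrow> A \<in> herm_mats"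
  by (auto simp: herm_mats_def ctranspose_def vec_eq_iff)

lemma subspace_herm: "subspace herm_mats"
  by (auto simp: subspace_def herm_cnj intro!: herm_matsI)

lemma closed_herm: "closed herm_mats"
  using closed_subspace subspace_herm by blast

lemma outer_herm: "outer u u \<in> herm_mats"
  by (rule herm_matsI) (simp add: outer_def)

lemma ctranspose_adjoint: "x \<bullet> (A *v y) = (ctranspose A *v x) \<bullet> y"
  for A :: "complex^'n^'m"
proof -
  have "x $ i \<bullet> (A $ i $ j * y $ j) = (ctranspose A $ j $ i * x $ i) \<bullet> y $ j" for i j
    by (simp add: inner_complex_Re ctranspose_def mult_ac)
  then have "x \<bullet> (A *v y) = (\<Sum>i\<in>UNIV. \<Sum>j\<in>UNIV. (ctranspose A $ j $ i * x $ i) \<bullet> y $ j)"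
    by (simp add: inner_vec_def matrix_vector_mult_def inner_sum_right)
  also have "\<dots> = (ctranspose A *v x) \<bullet> y"
    by (subst sum.swap) (simp add: inner_vec_def matrix_vector_mult_def inner_sum_left)
  finally show ?thesis .
qed

lemma herm_self_adjoint: "A \<in> herm_mats \<Longrightarrow> x \<bullet> (A *v y) = (A *v x) \<bullet> y"
  by (simp add: ctranspose_adjoint herm_mats_def)

text \<open>In this form the cone is an intersection of half-spaces within the Hermitian matrices,
  from which convexity and closedness are read off.\<close>

lemma psd_iff: "A \<in> psd_mats \<longleftrightarrow> A \<in> herm_mats \<and> (\<forall>x. 0 \<le> A \<bullet> outer x x)"
  unfolding inner_outer by (simp add: psd_mats_def inner_vec_def inner_complex_Re)

lemma psd_herm: "A \<in> psd_mats \<Longrightarrow> A \<in> herm_mats"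
  by (simp add: psd_iff)

lemma psd_quad_nonneg: "A \<in> psd_mats \<Longrightarrow> 0 \<le> x \<bullet> (A *v x)"
  by (simp add: psd_iff inner_outer)

lemma psd_add: "A \<in> psd_mats \<Longrightarrow> B \<in> psd_mats \<Longrightarrow> A + B \<in> psd_mats"
  using subspace_add[OF subspace_herm] by (auto simp: psd_iff inner_add_left)

lemma psd_scaleR: "A \<in> psd_mats \<Longrightarrow> 0 \<le> c \<Longrightarrow> c *\<^sub>R A \<in> psd_mats"
  using subspace_scale[OF subspace_herm] by (auto simp: psd_iff)

lemma psd_0: "0 \<in> psd_mats"
  using subspace_0[OF subspace_herm] by (auto simp: psd_iff)

lemma psd_sum: "(\<And>i. i \<in> I \<Longrightarrow> A i \<in> psd_mats) \<Longrightarrow> sum A I \<in> psd_mats"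
  by (induction I rule: infinite_finite_induct) (auto simp: psd_0 psd_add)

lemma convex_psd: "convex psd_mats"
  by (auto simp: convex_def psd_add psd_scaleR)

lemma closed_psd: "closed psd_mats"
proof -
  have "psd_mats = herm_mats \<inter> (\<Inter>x. {A. 0 \<le> A \<bullet> outer x x})"
    by (auto simp: psd_iff)
  moreover have "closed {A. 0 \<le> A \<bullet> outer x x}" for x :: "complex^'n"
    by (intro closed_Collect_le continuous_intros)
  ultimately show ?thesis
    by (metis (no_types, lifting) closed_INT closed_Int closed_herm)
qed

lemma inner_outer_outer:
  "outer u u \<bullet> outer x x = (cmod (\<Sum>j\<in>UNIV. cnj (u $ j) * x $ j))\<^sup>2"
proof -
  define z where "z = (\<Sum>j\<in>UNIV. cnj (u $ j) * x $ j)"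
  have "outer u u \<bullet> outer x x = (\<Sum>i\<in>UNIV. Re (cnj (x $ i) * u $ i * z))"
    unfolding inner_outer inner_vec_def[of x] inner_complex_Re outer_mult_vec z_def
    by (simp only: mult.assoc)
  also have "\<dots> = Re ((\<Sum>i\<in>UNIV. cnj (x $ i) * u $ i) * z)"
    by (simp only: sum_distrib_right Re_sum)
  also have "(\<Sum>i\<in>UNIV. cnj (x $ i) * u $ i) = cnj z"
    by (simp add: z_def mult.commute)
  also have "Re (cnj z * z) = (cmod z)\<^sup>2"
    by (metis complex_norm_square mult.commute of_real_power Re_complex_of_real)
  finally show ?thesis by (simp add: z_def)
qed

lemma outer_psd: "outer u u \<in> psd_mats"
  by (simp add: psd_iff outer_herm inner_outer_outer)

lemma cmatrix_mult_scaleR: "A *v (c *\<^sub>R x) = c *\<^sub>R (A *v x)"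
  for A :: "complex^'n^'m"
  by (simp add: vec_eq_iff matrix_vector_mult_def scaleR_sum_right)

text \<open>With w = A z, the form at w - s z is affine in \<open>s\<close>, because its quadratic
  term is the form at \<open>z\<close>. Being nonnegative for every real \<open>s\<close>, it has
  slope zero, and the slope is a multiple of the squared norm of w.\<close>

lemma psd_quad_eq_0:
  assumes A: "A \<in> psd_mats" and z: "z \<bullet> (A *v z) = 0"
  shows "A *v z = 0"
proof -
  have h: "A \<in> herm_mats" using A by (rule psd_herm)
  define w where "w = A *v z"
  define q where "q = w \<bullet> (A *v w)"
  have q: "0 \<le> q" unfolding q_def by (rule psd_quad_nonneg[OF A])
  have zw: "z \<bullet> (A *v w) = w \<bullet> w"
    using herm_self_adjoint[OF h, of z w] by (simp add: w_def)
  have "(w - s *\<^sub>R z) \<bullet> (A *v (w - s *\<^sub>R z)) = q - 2 * s * (w \<bullet> w)" for s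
    using z zw by (simp add: matrix_vector_mult_diff_distrib inner_diff_left inner_diff_right
        cmatrix_mult_scaleR flip: w_def q_def)
  then have "0 \<le> q - 2 * s * (w \<bullet> w)" for s
    by (metis psd_quad_nonneg[OF A])
  from this[of "(q + 1) / (w \<bullet> w)"] have "w \<bullet> w = 0"
    using q by (cases "w \<bullet> w = 0") auto
  then show ?thesis by (simp add: w_def)
qed

text \<open>One step of a Cholesky factorization; the remainder is the Schur complement of the entry
  \<open>(k, k)\<close>.\<close>

lemma psd_eliminate:
  fixes A :: "complex^'n^'n"
  assumes A: "A \<in> psd_mats"
  shows "\<exists>u. A - outer u u \<in> psd_mats \<and> (\<forall>j. (A - outer u u) $ k $ j = 0) \<and>
    (\<forall>i. A $ i $ k = 0 \<longrightarrow> u $ i = 0)"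
proof -
  have h: "A \<in> herm_mats" using A by (rule psd_herm)
  define a where "a = Re (A $ k $ k)"
  have Akk: "A $ k $ k = of_real a"
    using herm_cnj[OF h, of k k] unfolding a_def by (metis Reals_cnj_iff of_real_Re)
  have col: "(A *v axis k t) $ i = A $ i $ k * t" for t i
    by (simp add: matrix_vector_mult_def axis_def if_distrib cong: if_cong)
  have a0: "0 \<le> a"
    using psd_quad_nonneg[OF A, of "axis k 1"] by (simp add: inner_axis' col Akk inner_complex_Re)
  show ?thesis
  proof (cases "a = 0")
    case True
    \<comment> \<open>A vanishing diagonal entry forces its whole row and column to vanish, so u = 0
      serves.\<close>
    then have "A *v axis k 1 = 0"
      by (intro psd_quad_eq_0[OF A]) (simp add: inner_axis' col Akk)
    then have "A $ i $ k = 0" for i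
      using col[of 1 i] by simp
    then have "A $ k $ j = 0" for j
      using herm_cnj[OF h, of j k] by simp
    then show ?thesis using A by (intro exI[of _ 0]) (simp add: outer_def zero_vec_def[symmetric])
  next
    case False
    with a0 have a: "a > 0" by simp
    define u where "u = (\<chi> i. A $ i $ k / of_real (sqrt a))"
    have uu: "outer u u $ i $ j = A $ i $ k * A $ k $ j / of_real a" for i j
    proof -
      have "of_real (sqrt a) * of_real (sqrt a) = (of_real a :: complex)"
        using a by (simp flip: of_real_mult)
      then show ?thesis by (simp add: outer_def u_def herm_cnj[OF h])
    qed
    have "0 \<le> (A - outer u u) \<bullet> outer x x" for x
    proof -
      \<comment> \<open>Completing the square: x - t e_k minimizes the form over all multiples of
        the unit vector e_k, and the minimum is the form of the Schur complement at
        \<open>x\<close>.\<close>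
      define t where "t = (A *v x) $ k / of_real a"
      have Axk: "(A *v x) $ k = of_real a * t" using a by (simp add: t_def)
      have s: "(\<Sum>j\<in>UNIV. cnj (u $ j) * x $ j) = of_real (sqrt a) * t"
      proof -
        have "(\<Sum>j\<in>UNIV. cnj (u $ j) * x $ j) = (A *v x) $ k / of_real (sqrt a)"
          by (simp add: u_def herm_cnj[OF h] matrix_vector_mult_def sum_divide_distrib)
        also have "\<dots> = of_real (a / sqrt a) * t"
          unfolding Axk by simp
        finally show ?thesis by (simp add: real_div_sqrt a0)
      qed
      have sym: "x \<bullet> (A *v axis k t) = axis k t \<bullet> (A *v x)"
        using herm_self_adjoint[OF h, of x "axis k t"] by (simp add: inner_commute)
      have "0 \<le> (x - axis k t) \<bullet> (A *v (x - axis k t))"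
        by (rule psd_quad_nonneg[OF A])
      also have "\<dots> = x \<bullet> (A *v x) - 2 * (axis k t \<bullet> (A *v x)) + axis k t \<bullet> (A *v axis k t)"
        by (simp add: matrix_vector_mult_diff_distrib inner_diff_left inner_diff_right sym)
      also have "axis k t \<bullet> (A *v x) = a * (cmod t)\<^sup>2"
        by (simp add: inner_axis' Axk inner_complex_def cmod_power2 power2_eq_square[of "Re t"]
            power2_eq_square[of "Im t"] algebra_simps)
      also have "axis k t \<bullet> (A *v axis k t) = a * (cmod t)\<^sup>2"
        by (simp add: inner_axis' col Akk inner_complex_def cmod_power2 power2_eq_square[of "Re t"]
            power2_eq_square[of "Im t"] algebra_simps)
      finally have "0 \<le> x \<bullet> (A *v x) - a * (cmod t)\<^sup>2" by simp
      also have "a * (cmod t)\<^sup>2 = outer u u \<bullet> outer x x"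
        unfolding inner_outer_outer s using a0 by (simp add: norm_mult power_mult_distrib)
      finally show ?thesis unfolding inner_diff_left inner_outer[of A] by simp
    qed
    then have "A - outer u u \<in> psd_mats"
      using subspace_diff[OF subspace_herm h outer_herm] by (simp add: psd_iff)
    moreover have "(A - outer u u) $ k $ j = 0" for j
      using a by (simp add: uu Akk)
    ultimately show ?thesis
      by (intro exI[of _ u]) (simp add: u_def)
  qed
qed

text \<open>Repeated elimination. The induction set \<open>T\<close> holds the indices of rows that
  may still be nonzero; eliminating \<open>k\<close> clears its row, and cleared rows stay cleared
  because \<open>v\<close> vanishes wherever column \<open>k\<close> does.\<close>

lemma psd_eq_sum_outer:
  fixes A :: "complex^'n^'n"
  assumes "A \<in> psd_mats"
  obtains u :: "'n \<Rightarrow> complex^'n" where "A = (\<Sum>i\<in>UNIV. outer (u i) (u i))"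
proof -
  have "\<exists>u. B = (\<Sum>i\<in>T. outer (u i) (u i))"
    if "finite T" "B \<in> psd_mats" "\<And>i j. B $ i $ j \<noteq> 0 \<Longrightarrow> i \<in> T" for T :: "'n set" and B
    using that
  proof (induction T arbitrary: B rule: finite_induct)
    case empty
    then show ?case by (auto simp: vec_eq_iff)
  next
    case (insert k T)
    obtain v where v: "B - outer v v \<in> psd_mats" "\<And>j. (B - outer v v) $ k $ j = 0"
      "\<And>i. B $ i $ k = 0 \<Longrightarrow> v $ i = 0"
      using psd_eliminate[OF insert.prems(1)] by blast
    have "\<exists>u. B - outer v v = (\<Sum>i\<in>T. outer (u i) (u i))"
    proof (rule insert.IH[OF v(1)])
      fix i j assume nz: "(B - outer v v) $ i $ j \<noteq> 0"
      show "i \<in> T"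
      proof (rule ccontr)
        assume "i \<notin> T"
        with nz v(2) have "i \<notin> insert k T" by auto
        then have "B $ i $ j = 0" "v $ i = 0" using insert.prems(2) v(3) by auto
        with nz show False by (simp add: outer_def)
      qed
    qed
    then obtain u where "B - outer v v = (\<Sum>i\<in>T. outer (u i) (u i))" by blast
    moreover have "(\<Sum>i\<in>T. outer ((u(k := v)) i) ((u(k := v)) i)) = (\<Sum>i\<in>T. outer (u i) (u i))"
      using insert.hyps by (intro sum.cong) auto
    ultimately have "B = (\<Sum>i\<in>insert k T. outer ((u(k := v)) i) ((u(k := v)) i))"
      using insert.hyps by (simp add: algebra_simps)
    then show ?case by blast
  qed
  from this[of UNIV A] assms have "\<exists>u :: 'n \<Rightarrow> complex^'n. A = (\<Sum>i\<in>UNIV. outer (u i) (u i))"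
    by simp
  with that show thesis by blast
qed

text \<open>One half of the self-duality of the cone, reduced to rank-one matrices by the
  factorization.\<close>

lemma psd_inner_nonneg:
  fixes A B :: "complex^'n^'n"
  assumes "A \<in> psd_mats" "B \<in> psd_mats"
  shows "0 \<le> A \<bullet> B"
proof -
  obtain u :: "'n \<Rightarrow> complex^'n" where "B = (\<Sum>i\<in>UNIV. outer (u i) (u i))"
    by (rule psd_eq_sum_outer[OF assms(2)])
  then show ?thesis
    using assms(1) by (auto simp: inner_sum_right psd_iff intro: sum_nonneg)
qed

text \<open>Compactness of the unit sphere of \<open>V\<close> gives a positive minimum, and
  homogeneity extends it. It is applied to the kernel of a semidefinite matrix, to the orthogonal
  complement of that kernel, and to the whole space.\<close>

lemma quad_lower_bound_on_subspace:
  fixes A :: "complex^'n^'n"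
  assumes V: "subspace V" and pos: "\<And>v. v \<in> V \<Longrightarrow> v \<noteq> 0 \<Longrightarrow> 0 < v \<bullet> (A *v v)"
  shows "\<exists>c>0. \<forall>v\<in>V. c * (norm v)\<^sup>2 \<le> v \<bullet> (A *v v)"
proof (cases "V \<inter> sphere 0 1 = {}")
  case True
  have "v = 0" if "v \<in> V" for v
  proof (rule ccontr)
    assume "v \<noteq> 0"
    then have "(1 / norm v) *\<^sub>R v \<in> V \<inter> sphere 0 1"
      using that by (simp add: subspace_scale[OF V])
    with True show False by blast
  qed
  then show ?thesis by (intro exI[of _ 1]) force
next
  case False
  have "compact (V \<inter> sphere 0 1)"
    using closed_subspace[OF V] by (simp add: closed_Int_compact)
  moreover have "continuous_on (V \<inter> sphere 0 1) (\<lambda>v. v \<bullet> (A *v v))"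
    unfolding matrix_vector_mult_def by (intro continuous_intros)
  ultimately obtain w where w: "w \<in> V \<inter> sphere 0 1"
    and min: "\<And>v. v \<in> V \<inter> sphere 0 1 \<Longrightarrow> w \<bullet> (A *v w) \<le> v \<bullet> (A *v v)"
    using continuous_attains_inf[OF _ False] by blast
  have "(w \<bullet> (A *v w)) * (norm v)\<^sup>2 \<le> v \<bullet> (A *v v)" if "v \<in> V" for v
  proof (cases "v = 0")
    case False
    define n where "n = norm v"
    have n: "n > 0" using False by (simp add: n_def)
    have "w \<bullet> (A *v w) \<le> ((1 / n) *\<^sub>R v) \<bullet> (A *v ((1 / n) *\<^sub>R v))"
      using False that by (intro min) (simp add: n_def subspace_scale[OF V])
    also have "\<dots> = (v \<bullet> (A *v v)) / n\<^sup>2"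
      by (simp add: cmatrix_mult_scaleR power2_eq_square)
    finally show ?thesis using n by (simp add: n_def field_simps)
  qed simp
  moreover have "0 < w \<bullet> (A *v w)"
    using w by (intro pos) auto
  ultimately show ?thesis by blast
qed

lemma norm_sum_outer_le: "norm (\<Sum>i\<in>I. outer (u i) (u i)) \<le> (\<Sum>i\<in>I. (norm (u i))\<^sup>2)"
  using norm_sum[of "\<lambda>i. outer (u i) (u i)" I] by (simp add: norm_outer power2_eq_square)

text \<open>The left side is the trace, that is, the inner product with the identity. Together with
  \<open>norm_sum_outer_le\<close> it makes trace and norm comparable, so bounds pass between a
  matrix and its factors.\<close>

lemma sum_norm_le_norm_sum_outer:
  "(\<Sum>i\<in>I. (norm (u i))\<^sup>2) \<le> norm (mat 1 :: complex^'n^'n) * norm (\<Sum>i\<in>I. outer (u i) (u i))"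
  for u :: "'i \<Rightarrow> complex^'n"
proof -
  have "(\<Sum>i\<in>I. (norm (u i))\<^sup>2) = mat 1 \<bullet> (\<Sum>i\<in>I. outer (u i) (u i))"
    by (simp add: inner_sum_right inner_outer power2_norm_eq_inner)
  also have "\<dots> \<le> norm (mat 1 :: complex^'n^'n) * norm (\<Sum>i\<in>I. outer (u i) (u i))"
    by (rule norm_cauchy_schwarz)
  finally show ?thesis .
qed

lemma scaleR_cmatrix_mult: "(c *\<^sub>R A) *v x = c *\<^sub>R (A *v x)"
  for A :: "complex^'n^'m"
  by (simp add: vec_eq_iff matrix_vector_mult_def scaleR_sum_right)

lemma subspace_ker: "subspace {v. A *v v = 0}" for A :: "complex^'n^'m"
  by (auto simp: subspace_def matrix_vector_right_distrib cmatrix_mult_scaleR)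

section \<open>Exposed faces of the cone and quadratic growth\<close>

text \<open>For semidefinite \<open>S\<close> this is the exposed face cut out by a supporting
  hyperplane. With \<open>S\<close> the gradient at a solution, minimizers are found in it.\<close>

definition psd_face :: "complex^'n^'n \<Rightarrow> (complex^'n^'n) set" where
  "psd_face S = {W \<in> psd_mats. S \<bullet> W = 0}"

lemma convex_psd_face: "convex (psd_face S)"
  by (auto simp: convex_def psd_face_def psd_add psd_scaleR inner_add_right)

text \<open>A vanishing sum of nonnegative terms has vanishing terms, so every factor of a member of
  the face lies in the kernel of \<open>S\<close>.\<close>

lemma psd_face_sum_outer:
  assumes S: "S \<in> psd_mats" and W: "(\<Sum>i\<in>I. outer (u i) (u i)) \<in> psd_face S"
    and "finite I" "i \<in> I"
  shows "S *v u i = 0"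
proof (rule psd_quad_eq_0[OF S])
  have "(\<Sum>i\<in>I. u i \<bullet> (S *v u i)) = 0"
    using W by (simp add: psd_face_def inner_sum_right inner_outer)
  then show "u i \<bullet> (S *v u i) = 0"
    using assms(3,4) psd_quad_nonneg[OF S] by (simp add: sum_nonneg_eq_0_iff)
qed

text \<open>Orthogonality in the real inner product suffices, because the kernel of \<open>S\<close> is closed under
  multiplication by \<open>\<i>\<close>.\<close>

lemma psd_face_mult_orthogonal_ker:
  fixes S :: "complex^'n^'n"
  assumes S: "S \<in> psd_mats" and W: "W \<in> psd_face S"
    and r: "\<And>v. S *v v = 0 \<Longrightarrow> v \<bullet> r = 0"
  shows "W *v r = 0"
proof -
  have "W \<in> psd_mats" using W by (simp add: psd_face_def)
  then obtain u :: "'n \<Rightarrow> complex^'n" where u: "W = (\<Sum>i\<in>UNIV. outer (u i) (u i))"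
    by (rule psd_eq_sum_outer)
  have "outer (u i) (u i) *v r = 0" for i
  proof -
    define z where "z = (\<Sum>j\<in>UNIV. cnj (u i $ j) * r $ j)"
    have ker: "S *v u i = 0"
      using psd_face_sum_outer[OF S, where u = u and I = UNIV] W u by simp
    then have "S *v (\<i> *s u i) = 0"
      by (simp add: vector_scalar_commute)
    from r[OF this] have "Im z = 0"
      by (simp add: inner_vec_def inner_complex_Re z_def algebra_simps)
    moreover have "Re z = 0"
      using r[OF ker] by (simp add: inner_vec_def inner_complex_Re z_def)
    ultimately have "z = 0" by (simp add: complex_eq_iff)
    then show ?thesis by (simp add: vec_eq_iff outer_mult_vec z_def)
  qed
  moreover have "(\<Sum>i\<in>I. outer (u i) (u i)) *v r = (\<Sum>i\<in>I. outer (u i) (u i) *v r)" for I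
    by (induction I rule: infinite_finite_induct) (auto simp: matrix_vector_mult_add_rdistrib)
  ultimately show ?thesis by (simp add: u)
qed

text \<open>\<open>Xs\<close> is a relative interior point of the face. Forms in the span of the
  face see only the component in the kernel of \<open>S\<close>, and there \<open>Xs\<close> is
  definite with some constant, which a perturbation of at most that norm cannot exceed.\<close>

lemma psd_face_interior:
  fixes S Xs :: "complex^'n^'n"
  assumes S: "S \<in> psd_mats" and Xs: "Xs \<in> psd_face S"
    and pos: "\<And>v. S *v v = 0 \<Longrightarrow> v \<noteq> 0 \<Longrightarrow> 0 < v \<bullet> (Xs *v v)"
  shows "\<exists>e>0. \<forall>D\<in>span (psd_face S). norm D \<le> e \<longrightarrow> Xs + D \<in> psd_face S"
proof -
  define V where "V = {v. S *v v = 0}"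
  have V: "subspace V" unfolding V_def by (rule subspace_ker)
  obtain c where c: "c > 0" "\<And>v. v \<in> V \<Longrightarrow> c * (norm v)\<^sup>2 \<le> v \<bullet> (Xs *v v)"
    using quad_lower_bound_on_subspace[OF V, of Xs] pos by (auto simp: V_def)
  \<comment> \<open>The relations that define \<open>U\<close> are linear, so they pass from the
    face to its span.\<close>
  define U where "U = {D \<in> herm_mats. S \<bullet> D = 0 \<and> (\<forall>r. (\<forall>v\<in>V. v \<bullet> r = 0) \<longrightarrow> D *v r = 0)}"
  have FU: "psd_face S \<subseteq> U"
    using psd_face_mult_orthogonal_ker[OF S] by (auto simp: U_def V_def psd_face_def psd_herm)
  moreover have "subspace U"
    using subspace_add[OF subspace_herm] subspace_scale[OF subspace_herm] subspace_0[OF subspace_herm]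
    by (auto simp: subspace_def U_def inner_add_right matrix_vector_mult_add_rdistrib
        scaleR_cmatrix_mult)
  ultimately have span: "span (psd_face S) \<subseteq> U" by (rule span_minimal)
  have "Xs + D \<in> psd_face S" if D: "D \<in> span (psd_face S)" "norm D \<le> c" for D
  proof -
    have M: "Xs + D \<in> U"
      using D(1) span Xs FU \<open>subspace U\<close> by (meson subsetD subspace_add)
    then have h: "Xs + D \<in> herm_mats" by (simp add: U_def)
    have "0 \<le> x \<bullet> ((Xs + D) *v x)" for x
    proof -
      obtain p r where p: "p \<in> V" and r: "\<And>v. v \<in> V \<Longrightarrow> orthogonal r v" and x: "x = p + r"
        using orthogonal_subspace_decomp_exists[of V x] V by (metis span_eq_iff)
      have "(Xs + D) *v r = 0"
        using M r by (auto simp: U_def orthogonal_def inner_commute)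
      then have eq: "(Xs + D) *v x = (Xs + D) *v p"
        by (simp add: x matrix_vector_right_distrib)
      have "\<bar>D \<bullet> outer p p\<bar> \<le> norm D * norm (outer p p)"
        by (rule Cauchy_Schwarz_ineq2)
      also have "\<dots> \<le> c * (norm p)\<^sup>2"
        using D(2) by (simp add: norm_outer power2_eq_square mult_right_mono)
      finally have "0 \<le> p \<bullet> ((Xs + D) *v p)"
        using c(2)[OF p] by (simp add: inner_outer matrix_vector_mult_add_rdistrib inner_add_right)
      also have "\<dots> = x \<bullet> ((Xs + D) *v x)"
        using herm_self_adjoint[OF h, of x p] eq by (simp add: inner_commute)
      finally show ?thesis .
    qed
    with h M show ?thesis by (simp add: psd_face_def psd_iff inner_outer U_def)
  qed
  with c(1) show ?thesis by blast
qed

text \<open>A linear right inverse of \<open>f\<close> on the image of \<open>E\<close> is bounded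
  in finite dimension. Hence a violated linear constraint can be repaired inside \<open>E\<close> at
  a cost proportional to the violation.\<close>

lemma linear_bounded_preimage:
  fixes f :: "'a::euclidean_space \<Rightarrow> 'b::euclidean_space"
  assumes f: "linear f" and E: "subspace E"
  obtains B where "B > 0" "\<And>x. x \<in> E \<Longrightarrow> \<exists>y\<in>E. f y = f x \<and> norm y \<le> B * norm (f x)"
proof -
  obtain g where g: "range g \<subseteq> E" "linear g" "\<And>v. v \<in> f ` E \<Longrightarrow> f (g v) = v"
    using linear_exists_right_inverse_on[OF f E] by auto
  obtain B where B: "B > 0" "\<And>z. norm (g z) \<le> B * norm z"
    using linear_bounded_pos[OF g(2)] by auto
  show thesis
    using B g by (intro that[of B] bexI[of _ "g (f x)" for x]) auto
qed

text \<open>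
  Writing \<open>X = \<Sum> u u\<^sup>H\<close> and dropping from each \<open>u\<close> its component \<open>r\<close> orthogonal to the
  kernel of \<open>S\<close> gives a point \<open>W\<close> of the face with \<open>\<parallel>X - W\<parallel>\<^sup>2\<close> of order \<open>S \<bullet> X\<close>.  The linear
  constraint is then restored by a correction \<open>D\<close> within the span of the face, and a convex
  combination with the relative interior point \<open>Xs\<close> restores semidefiniteness.
\<close>

lemma psd_face_quadratic_growth:
  fixes f :: "complex^'n^'n \<Rightarrow> 'b::euclidean_space" and S Xs :: "complex^'n^'n"
  assumes f: "linear f" and S: "S \<in> psd_mats" and Xs: "Xs \<in> psd_face S"
    and pos: "\<And>v. S *v v = 0 \<Longrightarrow> v \<noteq> 0 \<Longrightarrow> 0 < v \<bullet> (Xs *v v)"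
  obtains a where "a > 0"
    "\<And>X. X \<in> psd_mats \<Longrightarrow> norm X \<le> b \<Longrightarrow> \<exists>W\<in>psd_face S. f W = f Xs \<and>
       (norm (X - W))\<^sup>2 \<le> a * ((norm (f (X - Xs)))\<^sup>2 + S \<bullet> X)"
proof -
  define V where "V = {v. S *v v = 0}"
  have V: "subspace V" unfolding V_def by (rule subspace_ker)
  have "subspace (orthogonal_comp V)" by (rule subspace_orthogonal_comp)
  moreover have "0 < v \<bullet> (S *v v)" if v: "v \<in> orthogonal_comp V" "v \<noteq> 0" for v
  proof -
    have "v \<notin> V" using v by (auto simp: orthogonal_comp_def orthogonal_def)
    then have "v \<bullet> (S *v v) \<noteq> 0" using psd_quad_eq_0[OF S] by (auto simp: V_def)
    then show ?thesis using psd_quad_nonneg[OF S, of v] by simp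
  qed
  ultimately obtain c where c: "c > 0"
    and c_le: "\<And>v. v \<in> orthogonal_comp V \<Longrightarrow> c * (norm v)\<^sup>2 \<le> v \<bullet> (S *v v)"
    using quad_lower_bound_on_subspace by blast
  obtain e where e: "e > 0"
    and ri: "\<And>D. D \<in> span (psd_face S) \<Longrightarrow> norm D \<le> e \<Longrightarrow> Xs + D \<in> psd_face S"
    using psd_face_interior[OF S Xs pos] by blast
  obtain G where G: "G > 0" and preimage: "\<And>x. x \<in> span (psd_face S) \<Longrightarrow>
      \<exists>y\<in>span (psd_face S). f y = f x \<and> norm y \<le> G * norm (f x)"
    using linear_bounded_preimage[OF f subspace_span] by blast
  obtain Lf where Lf: "Lf > 0" "\<And>x. norm (f x) \<le> Lf * norm x"
    using linear_bounded_pos[OF f] by auto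
  define B where "B = norm (mat 1 :: complex^'n^'n) * \<bar>b\<bar>"
  have B: "B \<ge> 0" by (simp add: B_def)
  \<comment> \<open>With \<open>d\<close> the square root of the residual, \<open>a1\<close> will
    bound the distance from X to \<open>W\<close> and \<open>a2\<close> the norm of the correction
    \<open>D\<close>, both relative to \<open>d\<close>. \<open>a3\<close> is the cost, relative to
    the norm of \<open>D\<close>, of returning to the face.\<close>
  define a1 where "a1 = 2 * sqrt B / sqrt c"
  define a2 where "a2 = G * (1 + Lf * a1)"
  define a3 where "a3 = (norm Xs + B) / e + 1"
  have a1: "a1 \<ge> 0"
    using c B by (simp add: a1_def)
  then have a2: "a2 > 0"
    using G Lf(1) by (simp add: a2_def add_pos_nonneg)
  have a3: "a3 > 0"
    using e B by (simp add: a3_def add_nonneg_pos)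
  have main: "\<exists>W\<in>psd_face S. f W = f Xs \<and>
      norm (X - W) \<le> (a1 + a3 * a2) * sqrt ((norm (f (X - Xs)))\<^sup>2 + S \<bullet> X)"
    if X: "X \<in> psd_mats" and Xb: "norm X \<le> b" for X
  proof -
    define d where "d = sqrt ((norm (f (X - Xs)))\<^sup>2 + S \<bullet> X)"
    have SX: "0 \<le> S \<bullet> X" using psd_inner_nonneg[OF S X] .
    have d1: "norm (f (X - Xs)) \<le> d" and d2: "sqrt (S \<bullet> X) \<le> d"
      using SX by (auto simp: d_def intro!: real_le_rsqrt)
    obtain u :: "'n \<Rightarrow> complex^'n" where u: "X = (\<Sum>i\<in>UNIV. outer (u i) (u i))"
      using X by (rule psd_eq_sum_outer)
    have "\<exists>p r. p \<in> V \<and> r \<in> orthogonal_comp V \<and> u i = p + r" for i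
    proof -
      obtain p r where "p \<in> span V" "\<And>w. w \<in> span V \<Longrightarrow> orthogonal r w" "u i = p + r"
        using orthogonal_subspace_decomp_exists[of V "u i"] by blast
      moreover have "span V = V" using V by (simp add: span_eq_iff)
      ultimately show ?thesis by (auto simp: orthogonal_comp_def orthogonal_commute)
    qed
    then obtain p r where pr: "\<And>i. p i \<in> V \<and> r i \<in> orthogonal_comp V \<and> u i = p i + r i"
      by metis
    then have p: "p i \<in> V" and r: "r i \<in> orthogonal_comp V" and upr: "u i = p i + r i" for i
      by blast+
    have orth: "orthogonal (p i) (r i)" for i
      using p[of i] r[of i] by (auto simp: orthogonal_comp_def)
    have pyth: "(norm (u i))\<^sup>2 = (norm (p i))\<^sup>2 + (norm (r i))\<^sup>2" for i
      using norm_add_Pythagorean[OF orth] by (simp add: upr)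
    have pu: "norm (p i) \<le> norm (u i)" for i
      using pyth[of i] by (auto intro!: power2_le_imp_le[of "norm (p i)"])
    have sumu: "(\<Sum>i\<in>UNIV. (norm (u i))\<^sup>2) \<le> B"
    proof -
      have "(\<Sum>i\<in>UNIV. (norm (u i))\<^sup>2) \<le> norm (mat 1 :: complex^'n^'n) * norm X"
        unfolding u by (rule sum_norm_le_norm_sum_outer)
      also have "\<dots> \<le> B"
        unfolding B_def using Xb by (intro mult_left_mono) auto
      finally show ?thesis .
    qed
    \<comment> \<open>Only the components \<open>r i\<close> contribute to the inner product of
      \<open>S\<close> and X, and \<open>S\<close> is definite on them.\<close>
    have "c * (\<Sum>i\<in>UNIV. (norm (r i))\<^sup>2) \<le> (\<Sum>i\<in>UNIV. r i \<bullet> (S *v r i))"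
      unfolding sum_distrib_left by (intro sum_mono c_le r)
    also have "\<dots> = S \<bullet> X"
    proof -
      have "u i \<bullet> (S *v u i) = r i \<bullet> (S *v r i)" for i
      proof -
        have "S *v p i = 0" using p by (simp add: V_def)
        moreover from this have "p i \<bullet> (S *v r i) = 0"
          by (simp add: herm_self_adjoint[OF psd_herm[OF S]])
        ultimately show ?thesis
          by (simp add: upr matrix_vector_right_distrib inner_add_left)
      qed
      then show ?thesis by (simp add: u inner_sum_right inner_outer)
    qed
    finally have sumr: "(\<Sum>i\<in>UNIV. (norm (r i))\<^sup>2) \<le> S \<bullet> X / c"
      using c by (simp add: field_simps)
    define W where "W = (\<Sum>i\<in>UNIV. outer (p i) (p i))"
    have WF: "W \<in> psd_face S"
      using p by (auto simp: psd_face_def W_def V_def inner_sum_right inner_outer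
          intro!: psd_sum outer_psd)
    have XW: "norm (X - W) \<le> a1 * d"
    proof -
      \<comment> \<open>Each difference u u^H - p p^H equals r u^H + p r^H. Every term contains
        \<open>r\<close>, so Cauchy-Schwarz gives the order of the square root of
        \<open>S \<bullet> X\<close>.\<close>
      have "X - W = (\<Sum>i\<in>UNIV. outer (r i) (u i) + outer (p i) (r i))"
        unfolding u W_def sum_subtractf[symmetric]
        by (intro sum.cong refl) (simp add: upr outer_add_left outer_add_right)
      also have "norm \<dots> \<le> (\<Sum>i\<in>UNIV. 2 * (norm (u i) * norm (r i)))"
      proof (rule order_trans[OF norm_sum sum_mono])
        fix i
        have "norm (outer (r i) (u i) + outer (p i) (r i)) \<le> norm (r i) * norm (u i) + norm (p i) * norm (r i)"
          by (metis norm_outer norm_triangle_ineq)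
        also have "\<dots> \<le> norm (r i) * norm (u i) + norm (u i) * norm (r i)"
          by (intro add_left_mono mult_right_mono pu) auto
        finally show "norm (outer (r i) (u i) + outer (p i) (r i)) \<le> 2 * (norm (u i) * norm (r i))"
          by (simp add: mult.commute)
      qed
      also have "\<dots> \<le> 2 * (sqrt (\<Sum>i\<in>UNIV. (norm (u i))\<^sup>2) * sqrt (\<Sum>i\<in>UNIV. (norm (r i))\<^sup>2))"
        using L2_set_mult_ineq[of "\<lambda>i. norm (u i)" "\<lambda>i. norm (r i)" UNIV]
        by (simp add: L2_set_def flip: sum_distrib_left)
      also have "\<dots> \<le> 2 * (sqrt B * sqrt (S \<bullet> X / c))"
        using sumu sumr B by (intro mult_left_mono mult_mono) (auto intro: sum_nonneg)
      also have "\<dots> = a1 * sqrt (S \<bullet> X)"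
        by (simp add: a1_def real_sqrt_divide)
      also have "\<dots> \<le> a1 * d"
        by (intro mult_left_mono d2 a1)
      finally show ?thesis .
    qed
    have WB: "norm W \<le> B"
    proof -
      have "norm W \<le> (\<Sum>i\<in>UNIV. (norm (p i))\<^sup>2)"
        unfolding W_def by (rule norm_sum_outer_le)
      also have "\<dots> \<le> (\<Sum>i\<in>UNIV. (norm (u i))\<^sup>2)"
        by (intro sum_mono power_mono pu) auto
      finally show ?thesis using sumu by simp
    qed
    \<comment> \<open>W + D satisfies the constraint but may leave the cone.\<close>
    obtain D where D: "D \<in> span (psd_face S)" and fD: "f D = f (Xs - W)"
      and Dn: "norm D \<le> G * norm (f (Xs - W))"
      using preimage[of "Xs - W"] WF Xs by (meson span_base span_diff)
    have "norm (f (Xs - W)) = norm (f (X - W) - f (X - Xs))"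
      by (simp add: linear_diff[OF f])
    also have "\<dots> \<le> Lf * norm (X - W) + d"
      using norm_triangle_ineq4[of "f (X - W)" "f (X - Xs)"] Lf(2)[of "X - W"] d1 by linarith
    also have "\<dots> \<le> Lf * (a1 * d) + d"
      using XW Lf(1) by simp
    finally have "norm (f (Xs - W)) \<le> (1 + Lf * a1) * d"
      by (simp add: algebra_simps)
    then have Dd: "norm D \<le> a2 * d"
      using order_trans[OF Dn mult_left_mono[of "norm (f (Xs - W))" "(1 + Lf * a1) * d" G]] G
      by (simp add: a2_def mult.assoc)
    define n where "n = norm D"
    \<comment> \<open>This weight makes t e / n equal to 1 - t, so that \<open>Z\<close> below is
      both (1 - t) W + t Y, a member of the face, and (1 - t) (W + D) + t Xs, which satisfies the
      constraint. For n = 0 the quotient e / n is 0 and D = 0, so \<open>Y\<close> is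
      \<open>Xs\<close>.\<close>
    define t where "t = n / (e + n)"
    have n: "n \<ge> 0" by (simp add: n_def)
    have t: "0 \<le> t" "t \<le> 1" "t \<le> n / e"
      using e n by (auto simp: t_def field_simps)
    define Y where "Y = Xs + (e / n) *\<^sub>R D"
    have YF: "Y \<in> psd_face S"
      unfolding Y_def using e D by (intro ri span_scale) (auto simp: n_def)
    define Z where "Z = (1 - t) *\<^sub>R W + t *\<^sub>R Y"
    have ZF: "Z \<in> psd_face S"
      unfolding Z_def using convex_psd_face[of S] WF YF t by (auto simp: convex_alt)
    have tY: "t *\<^sub>R Y = t *\<^sub>R Xs + (1 - t) *\<^sub>R D"
    proof (cases "n = 0")
      case True
      then show ?thesis by (simp add: Y_def n_def)
    next
      case False
      then have "t * (e / n) = 1 - t" using e n by (simp add: t_def field_simps)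
      then show ?thesis by (simp add: Y_def scaleR_right_distrib)
    qed
    have "f Z = f Xs"
    proof -
      have "Z = (1 - t) *\<^sub>R (W + D) + t *\<^sub>R Xs"
        unfolding Z_def tY by (simp add: algebra_simps)
      then have "f Z = (1 - t) *\<^sub>R (f W + f D) + t *\<^sub>R f Xs"
        by (simp add: linear_add[OF f] linear_scale[OF f])
      also have "f W + f D = f Xs" by (simp add: fD linear_diff[OF f])
      finally show ?thesis by (simp add: algebra_simps)
    qed
    moreover have "norm (X - Z) \<le> (a1 + a3 * a2) * d"
    proof -
      have eq: "X - Z = (X - W) + t *\<^sub>R (W - Xs) - (1 - t) *\<^sub>R D"
        unfolding Z_def tY by (simp add: algebra_simps)
      have "norm (t *\<^sub>R (W - Xs)) = t * norm (W - Xs)" "norm ((1 - t) *\<^sub>R D) = (1 - t) * n"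
        using t by (simp_all add: n_def)
      then have "norm (X - Z) \<le> norm (X - W) + t * norm (W - Xs) + (1 - t) * n"
        unfolding eq
        using norm_triangle_ineq4[of "(X - W) + t *\<^sub>R (W - Xs)" "(1 - t) *\<^sub>R D"]
          norm_triangle_ineq[of "X - W" "t *\<^sub>R (W - Xs)"]
        by linarith
      also have "t * norm (W - Xs) \<le> (n / e) * (norm Xs + B)"
        using t WB norm_triangle_ineq4[of W Xs] n e B by (intro mult_mono) auto
      also have "(1 - t) * n \<le> n" using t n by (simp add: mult_left_le_one_le)
      finally have "norm (X - Z) \<le> norm (X - W) + a3 * n"
        by (simp add: a3_def field_simps add_divide_distrib)
      also have "\<dots> \<le> a1 * d + a3 * (a2 * d)"
        using XW Dd a3 by (intro add_mono mult_left_mono) (auto simp: n_def)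
      finally show ?thesis by (simp add: algebra_simps)
    qed
    ultimately show ?thesis using ZF by (auto simp: d_def)
  qed
  define a where "a = (a1 + a3 * a2)\<^sup>2"
  have "a > 0"
    using add_nonneg_pos[OF a1 mult_pos_pos[OF a3 a2]] by (simp add: a_def)
  moreover have "\<exists>W\<in>psd_face S. f W = f Xs \<and>
      (norm (X - W))\<^sup>2 \<le> a * ((norm (f (X - Xs)))\<^sup>2 + S \<bullet> X)"
    if X: "X \<in> psd_mats" and Xb: "norm X \<le> b" for X
  proof -
    obtain W where W: "W \<in> psd_face S" "f W = f Xs"
      "norm (X - W) \<le> (a1 + a3 * a2) * sqrt ((norm (f (X - Xs)))\<^sup>2 + S \<bullet> X)"
      using main[OF X Xb] by blast
    have "(norm (X - W))\<^sup>2 \<le> ((a1 + a3 * a2) * sqrt ((norm (f (X - Xs)))\<^sup>2 + S \<bullet> X))\<^sup>2"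
      using W(3) by (intro power_mono) auto
    also have "\<dots> = a * ((norm (f (X - Xs)))\<^sup>2 + S \<bullet> X)"
      using psd_inner_nonneg[OF S X] by (simp add: power_mult_distrib a_def)
    finally show ?thesis using W by blast
  qed
  ultimately show thesis by (rule that)
qed

section \<open>The optimization problem\<close>

text \<open>The expansion is exact because the objective is quadratic. It yields convexity and, at a
  solution, the formula for the gap.\<close>

lemma ffun_expand:
  "ffun P Y = ffun P X + grad_f P X \<bullet> (Y - X) + (norm (meas P (Y - X)))\<^sup>2 / 2"
proof -
  have m: "meas P Y - bvec P = (meas P X - bvec P) + meas P (Y - X)"
    by (simp add: linear_diff[OF linear_meas])
  have g: "grad_f P X \<bullet> (Y - X) =
      (meas P X - bvec P) \<bullet> meas P (Y - X) + mu P * (Rmat P \<bullet> Y) - mu P * (Rmat P \<bullet> X)"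
    using adjoint_works[OF linear_meas, of "Y - X" P "meas P X - bvec P"]
    by (simp add: grad_f_def inner_add_left inner_diff_right inner_commute algebra_simps)
  have "(norm (meas P Y - bvec P))\<^sup>2 = (norm (meas P X - bvec P))\<^sup>2
      + 2 * ((meas P X - bvec P) \<bullet> meas P (Y - X)) + (norm (meas P (Y - X)))\<^sup>2"
    unfolding m power2_norm_eq_inner by (simp only: inner_add_left inner_add_right inner_commute)
  then show ?thesis
    unfolding ffun_def g by simp
qed

lemma ffun_ge_tangent: "ffun P X + grad_f P X \<bullet> (Y - X) \<le> ffun P Y"
  using ffun_expand[of P Y X] by simp

lemma inner_grad_f_diff: "(grad_f P Y - grad_f P X) \<bullet> D = meas P (Y - X) \<bullet> meas P D"
  using adjoint_works[OF linear_meas, of D P "meas P Y - bvec P"]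
    adjoint_works[OF linear_meas, of D P "meas P X - bvec P"]
  by (simp add: grad_f_def linear_diff[OF linear_meas] inner_diff_left inner_add_left
      inner_diff_right inner_commute)

lemma continuous_on_ffun: "continuous_on A (ffun P)"
proof -
  have "continuous_on A (meas P)"
    by (intro linear_continuous_on) (simp add: linear_meas flip: linear_conv_bounded_linear)
  then show ?thesis unfolding ffun_def by (intro continuous_intros)
qed

lemma hfun_psd: "X \<in> psd_mats \<Longrightarrow> hfun P X = ereal (ffun P X)"
  by (simp add: hfun_def gfun_def)

lemma minimizers_iff:
  "X \<in> minimizers P \<longleftrightarrow> X \<in> psd_mats \<and> (\<forall>Y\<in>psd_mats. ffun P X \<le> ffun P Y)"
proof
  assume "X \<in> minimizers P"
  then have min: "hfun P X \<le> hfun P Y" if "Y \<in> herm_mats" for Y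
    using that by (auto simp: minimizers_def is_arg_min_def not_less)
  \<comment> \<open>Comparison with the feasible point 0 makes the value at \<open>X\<close>
    finite.\<close>
  have "hfun P X \<le> ereal (ffun P 0)"
    using min[OF psd_herm[OF psd_0]] by (simp add: hfun_psd psd_0)
  then have X: "X \<in> psd_mats"
    by (auto simp: hfun_def gfun_def split: if_splits)
  then show "X \<in> psd_mats \<and> (\<forall>Y\<in>psd_mats. ffun P X \<le> ffun P Y)"
    using min by (metis ereal_less_eq(3) hfun_psd psd_herm)
next
  assume "X \<in> psd_mats \<and> (\<forall>Y\<in>psd_mats. ffun P X \<le> ffun P Y)"
  then show "X \<in> minimizers P"
    by (auto simp: minimizers_def is_arg_min_def not_less hfun_def gfun_def psd_herm)
qed

section \<open>Projected gradient steps\<close>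

lemma prox_g_psd_and_obtuse:
  fixes X :: "complex^'n^'n"
  assumes a: "\<alpha> > 0"
  shows "prox_g \<alpha> X \<in> psd_mats \<and> (\<forall>W\<in>psd_mats. (X - prox_g \<alpha> X) \<bullet> (W - prox_g \<alpha> X) \<le> 0)"
proof -
  define F where "F Y = gfun Y + ereal (1 / (2 * \<alpha>) * (norm (Y - X))\<^sup>2)" for Y
  define c where "c = closest_point psd_mats X"
  have ne: "psd_mats \<noteq> ({} :: (complex^'n^'n) set)" using psd_0 by blast
  have c: "c \<in> psd_mats" unfolding c_def by (rule closest_point_in_set[OF closed_psd ne])
  have F_psd: "F Y = ereal (1 / (2 * \<alpha>) * (norm (Y - X))\<^sup>2)" if "Y \<in> psd_mats" for Y
    using that by (simp add: F_def gfun_def)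
  have F_not: "F Y = \<infinity>" if "Y \<notin> psd_mats" for Y
    using that by (simp add: F_def gfun_def)
  have F_less: "F Y < F W \<longleftrightarrow> norm (Y - X) < norm (W - X)" if "Y \<in> psd_mats" "W \<in> psd_mats" for Y W
  proof -
    have "F Y < F W \<longleftrightarrow> (norm (Y - X))\<^sup>2 < (norm (W - X))\<^sup>2"
      using a that by (simp add: F_psd divide_less_cancel)
    then show ?thesis
      by (meson norm_ge_zero pos2 power_strict_mono power2_less_imp_less)
  qed
  have "\<not> F Y < F c" for Y
  proof (cases "Y \<in> psd_mats")
    case True
    then show ?thesis
      using closest_point_le[OF closed_psd True, of X] c
      by (simp add: F_less c_def dist_norm norm_minus_commute)
  qed (simp add: F_not)
  then have "is_arg_min F (\<lambda>Y. Y \<in> herm_mats) c"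
    using psd_herm[OF c] by (simp add: is_arg_min_def)
  \<comment> \<open>\<open>arg_min\<close> is a choice operator: only the existence of the minimizer
    \<open>c\<close> ensures that the chosen point is itself a minimizer.\<close>
  then have Z: "is_arg_min F (\<lambda>Y. Y \<in> herm_mats) (prox_g \<alpha> X)"
    unfolding prox_g_def arg_min_def F_def by (rule someI)
  then have nl: "\<not> F W < F (prox_g \<alpha> X)" if "W \<in> herm_mats" for W
    using that by (simp add: is_arg_min_def)
  have Zp: "prox_g \<alpha> X \<in> psd_mats"
    using nl[OF psd_herm[OF c]] F_psd[OF c] F_not by fastforce
  moreover have "\<forall>W\<in>psd_mats. dist X (prox_g \<alpha> X) \<le> dist X W"
    using nl F_less[OF _ Zp] psd_herm by (metis dist_commute dist_norm not_less)
  ultimately show ?thesis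
    using any_closest_point_dot[OF convex_psd closed_psd] by blast
qed

lemma prox_step_psd: "\<alpha> > 0 \<Longrightarrow> prox_step P Y \<alpha> \<in> psd_mats"
  using prox_g_psd_and_obtuse by (auto simp: prox_step_def)

text \<open>The obtuse angle property at the projected point, rearranged so that the gradient at
  \<open>Y\<close> is compared with the displacement of the step.\<close>

lemma prox_step_grad_le:
  assumes a: "\<alpha> > 0" and W: "W \<in> psd_mats"
  shows "(Y - prox_step P Y \<alpha>) \<bullet> (W - prox_step P Y \<alpha>) / \<alpha> \<le> grad_f P Y \<bullet> (W - prox_step P Y \<alpha>)"
proof -
  define Z where "Z = prox_step P Y \<alpha>"
  have "(Y - \<alpha> *\<^sub>R grad_f P Y - Z) \<bullet> (W - Z) \<le> 0"
    using prox_g_psd_and_obtuse[OF a] W by (auto simp: Z_def prox_step_def)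
  then have "(Y - Z) \<bullet> (W - Z) \<le> \<alpha> * (grad_f P Y \<bullet> (W - Z))"
    by (simp add: inner_diff_left)
  then show ?thesis using a by (simp add: Z_def field_simps)
qed

text \<open>Divided by the step size, condition (A) bounds the derivative at \<open>Z\<close> in
  direction X - Z from below: the projection inequality supplies the gradient at \<open>Y\<close>,
  and the term in \<open>meas\<close> moves it to \<open>Z\<close>. Convexity concludes, and
  \<open>Y\<close> may lie outside the cone.\<close>

lemma prox_step_descent:
  fixes Y Z :: "complex^'n^'n"
  assumes a: "\<alpha> > 0" and X: "X \<in> psd_mats"
    and A: "(Y - Z) \<bullet> (X - Z) - \<alpha> * (meas P (Y - Z) \<bullet> meas P (X - Z)) \<ge> g * (norm (X - Z))\<^sup>2"
    and Z: "Z = prox_step P Y \<alpha>"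
  shows "g / \<alpha> * (norm (X - Z))\<^sup>2 \<le> ffun P X - ffun P Z"
proof -
  have "g / \<alpha> * (norm (X - Z))\<^sup>2 \<le> (Y - Z) \<bullet> (X - Z) / \<alpha> - meas P (Y - Z) \<bullet> meas P (X - Z)"
    using A a by (simp add: field_simps)
  also have "\<dots> \<le> grad_f P Y \<bullet> (X - Z) - meas P (Y - Z) \<bullet> meas P (X - Z)"
    using prox_step_grad_le[OF a X, of Y P] by (simp add: Z)
  also have "\<dots> = grad_f P Z \<bullet> (X - Z)"
    using inner_grad_f_diff[of P Y Z "X - Z"] by (simp add: inner_diff_left)
  also have "\<dots> \<le> ffun P X - ffun P Z"
    using ffun_ge_tangent[of P Z X] by simp
  finally show ?thesis .
qed

text \<open>Convexity and the projection inequality bound the gap e by a multiple of the step length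
  times the distance from \<open>Z\<close> to \<open>W\<close>. Growth bounds the square of that
  distance by a multiple of e; squaring and cancelling one e leaves the squared step length.\<close>

lemma prox_step_residual:
  fixes X Z :: "complex^'n^'n" and P :: "('n, 'm::finite) sdp_problem"
  assumes al: "0 < l" "l \<le> \<alpha>" and W: "W \<in> psd_mats"
    and Z: "Z = prox_step P X \<alpha>"
    and Lf: "\<And>D. norm (meas P D) \<le> Lf * norm D"
    and a: "0 \<le> a" and growth: "(norm (Z - W))\<^sup>2 \<le> a * (ffun P Z - ffun P W)"
  shows "ffun P Z - ffun P W \<le> a * (1 / l + Lf\<^sup>2)\<^sup>2 * (norm (X - Z))\<^sup>2"
proof -
  define e where "e = ffun P Z - ffun P W"
  define M where "M = 1 / l + Lf\<^sup>2"
  have M: "M > 0" using al by (simp add: M_def add_pos_nonneg)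
  have "e \<le> grad_f P Z \<bullet> (Z - W)"
    using ffun_ge_tangent[of P Z W] by (simp add: e_def inner_diff_right)
  also have "\<dots> = meas P (X - Z) \<bullet> meas P (W - Z) - grad_f P X \<bullet> (W - Z)"
    using inner_grad_f_diff[of P X Z "W - Z"] by (simp add: inner_diff_left inner_diff_right)
  also have "\<dots> \<le> meas P (X - Z) \<bullet> meas P (W - Z) - (X - Z) \<bullet> (W - Z) / \<alpha>"
    using prox_step_grad_le[of \<alpha> W X P] al W by (simp add: Z)
  also have "\<dots> \<le> norm (meas P (X - Z)) * norm (meas P (W - Z)) + norm (X - Z) * norm (W - Z) / \<alpha>"
  proof -
    have "- ((X - Z) \<bullet> (W - Z)) \<le> norm (X - Z) * norm (W - Z)"
      using Cauchy_Schwarz_ineq2[of "X - Z" "W - Z"] by linarith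
    then have "- ((X - Z) \<bullet> (W - Z)) / \<alpha> \<le> norm (X - Z) * norm (W - Z) / \<alpha>"
      using al by (intro divide_right_mono) auto
    then show ?thesis
      using norm_cauchy_schwarz[of "meas P (X - Z)" "meas P (W - Z)"] by simp
  qed
  also have "\<dots> \<le> (Lf * norm (X - Z)) * (Lf * norm (W - Z)) + norm (X - Z) * norm (W - Z) / l"
  proof (intro add_mono mult_mono Lf divide_left_mono)
    show "0 \<le> Lf * norm (X - Z)" using Lf[of "X - Z"] norm_ge_zero order_trans by blast
  qed (use al in auto)
  also have "\<dots> = M * norm (X - Z) * norm (Z - W)"
    by (simp add: M_def power2_eq_square algebra_simps norm_minus_commute)
  finally have e: "e \<le> M * norm (X - Z) * norm (Z - W)" .
  show ?thesis
  proof (cases "e \<le> 0")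
    case True
    also have "0 \<le> a * M\<^sup>2 * (norm (X - Z))\<^sup>2" using a by simp
    finally show ?thesis by (simp add: e_def M_def)
  next
    case False
    have "e * e \<le> (M * norm (X - Z) * norm (Z - W))\<^sup>2"
      using e False by (simp add: power2_eq_square mult_mono)
    also have "\<dots> = (M * norm (X - Z))\<^sup>2 * (norm (Z - W))\<^sup>2"
      by (simp add: power_mult_distrib)
    also have "\<dots> \<le> (M * norm (X - Z))\<^sup>2 * (a * e)"
      unfolding e_def by (intro mult_left_mono growth) auto
    finally have "e * e \<le> (a * M\<^sup>2 * (norm (X - Z))\<^sup>2) * e"
      by (simp add: power_mult_distrib mult_ac)
    with False show ?thesis
      by (simp add: e_def M_def)
  qed
qed

section \<open>Strict complementarity, bounded sublevel sets and growth of the objective\<close>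

lemma strict_complementarity:
  fixes S Xs :: "complex^'n^'n"
  assumes Xs: "Xs \<in> psd_mats" and ri: "- S \<in> rel_interior (normal_cone_psd Xs)"
  shows "S \<in> psd_mats" "Xs \<in> psd_face S"
    "\<And>v. S *v v = 0 \<Longrightarrow> v \<noteq> 0 \<Longrightarrow> 0 < v \<bullet> (Xs *v v)"
proof -
  define N where "N = normal_cone_psd Xs"
  have N: "G \<in> N \<longleftrightarrow> G \<in> herm_mats \<and> (\<forall>Y\<in>psd_mats. G \<bullet> (Y - Xs) \<le> 0)" for G
    using Xs by (simp add: N_def normal_cone_psd_def)
  have "- S \<in> N" using ri rel_interior_subset unfolding N_def by blast
  then have h: "S \<in> herm_mats" and opt: "S \<bullet> (Y - Xs) \<ge> 0" if "Y \<in> psd_mats" for Y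
    using subspace_neg[OF subspace_herm, of "- S"] that by (auto simp: N)
  \<comment> \<open>Optimality is tested at Xs + x x^H for semidefiniteness, and then at 0 and 2 Xs
    for orthogonality.\<close>
  have "0 \<le> S \<bullet> outer x x" for x
    using opt[OF psd_add[OF Xs outer_psd[of x]]] by simp
  then show S: "S \<in> psd_mats"
    using h[OF psd_0] by (simp add: psd_iff)
  have "S \<bullet> Xs = 0"
    using opt[OF psd_0] opt[OF psd_scaleR[OF Xs, of 2]] by (simp add: inner_diff_right)
  then show "Xs \<in> psd_face S" using Xs by (simp add: psd_face_def)
  show "0 < v \<bullet> (Xs *v v)" if v: "S *v v = 0" "v \<noteq> 0" for v
  proof (rule ccontr)
    assume "\<not> 0 < v \<bullet> (Xs *v v)"
    then have Xv: "outer v v \<bullet> Xs = 0"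
      using psd_quad_nonneg[OF Xs, of v] by (simp add: inner_commute[of _ Xs] inner_outer)
    \<comment> \<open>If \<open>v\<close> were also isotropic for \<open>Xs\<close>, then - v v^H
      would be normal at \<open>Xs\<close>. From a relative interior point the segment coming from
      it can be prolonged within the cone, and testing the prolonged point at Xs + v v^H is
      contradictory.\<close>
    have "- outer v v \<in> N"
      using subspace_neg[OF subspace_herm outer_herm[of v]] psd_inner_nonneg[OF outer_psd[of v]] Xv
      by (simp add: N inner_diff_right)
    moreover have "convex N"
      by (auto simp: convex_def N inner_add_left intro!: subspace_add[OF subspace_herm]
          subspace_scale[OF subspace_herm] add_nonpos_nonpos mult_nonneg_nonpos)
    ultimately obtain e where e: "e > 1" "(1 - e) *\<^sub>R (- outer v v) + e *\<^sub>R (- S) \<in> N"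
      using ri convex_rel_interior_iff[of N "- S"] unfolding N_def[symmetric] by blast
    have "((1 - e) *\<^sub>R (- outer v v) + e *\<^sub>R (- S)) \<bullet> ((Xs + outer v v) - Xs) \<le> 0"
      using e(2) psd_add[OF Xs outer_psd[of v]] by (simp only: N)
    moreover have "S \<bullet> outer v v = 0" using v by (simp add: inner_outer)
    ultimately have "(e - 1) * (norm (outer v v))\<^sup>2 \<le> 0"
      by (simp add: inner_add_left inner_diff_left power2_norm_eq_inner algebra_simps)
    then have "norm (outer v v) = 0"
      using e(1) by (simp add: mult_le_0_iff)
    with v(2) show False by (simp add: norm_outer)
  qed
qed

lemma full_column_rank_injective:
  fixes A :: "complex^'n^'m"
  assumes "rank A = CARD('n)" "A *v v = 0"
  shows "v = 0"
proof -
  have "vec.span (rows A) = UNIV"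
    using assms(1) by (simp add: row_rank_def_gen card_cart_basis vec.dimension_def flip: vec.dim_eq_full)
  then show ?thesis
    using assms(2) matrix_left_invertible_span_rows_gen[of A] matrix_left_invertible_ker[of A] by blast
qed

text \<open>Full column rank makes the sum of the \<open>Kmat P m\<close> positive definite, so its
  inner product with a semidefinite X dominates the norm of X. Small objective values bound each
  measurement, the term in \<open>Rmat P\<close> being nonnegative.\<close>

lemma sublevel_bounded:
  fixes P :: "('n::finite, 'm::finite) sdp_problem"
  assumes P: "valid_problem P"
    and K: "\<And>m. Kmat P m = Khat m ** ctranspose (Khat m)"
    and rank: "rank (stack_ct Khat) = CARD('n)"
  obtains b where "\<And>X. X \<in> psd_mats \<Longrightarrow> ffun P X \<le> c \<Longrightarrow> norm X \<le> b"
proof -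
  define T where "T = (\<Sum>m\<in>UNIV. Kmat P m)"
  have quad: "v \<bullet> (T *v v) = (\<Sum>m\<in>UNIV. (norm (ctranspose (Khat m) *v v))\<^sup>2)" for v
  proof -
    have "v \<bullet> (Kmat P m *v v) = (norm (ctranspose (Khat m) *v v))\<^sup>2" for m
      unfolding K matrix_vector_mul_assoc[symmetric] ctranspose_adjoint[of v "Khat m"]
        power2_norm_eq_inner ..
    then show ?thesis
      unfolding T_def inner_outer[symmetric] inner_sum_left by simp
  qed
  have "0 < v \<bullet> (T *v v)" if "v \<noteq> 0" for v
  proof -
    have "\<not> (\<forall>m. ctranspose (Khat m) *v v = 0)"
    proof
      assume z: "\<forall>m. ctranspose (Khat m) *v v = 0"
      have "(stack_ct Khat *v v) $ p = (ctranspose (Khat (fst p)) *v v) $ snd p" for p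
        by (simp add: stack_ct_def matrix_vector_mult_def)
      with z have "stack_ct Khat *v v = 0" by (simp add: vec_eq_iff)
      with full_column_rank_injective[OF rank] that show False by blast
    qed
    then obtain m where "ctranspose (Khat m) *v v \<noteq> 0" by blast
    then show ?thesis unfolding quad by (intro sum_pos2[of _ m]) auto
  qed
  then obtain l where l: "l > 0" "\<And>v. l * (norm v)\<^sup>2 \<le> v \<bullet> (T *v v)"
    using quad_lower_bound_on_subspace[OF subspace_UNIV, of T] by auto
  \<comment> \<open>Each summand bounds \<open>Kmat P m \<bullet> X\<close> once the data residual
    is at most sqrt (2 c); \<open>l\<close> is the definiteness constant.\<close>
  define b where "b = (\<Sum>m\<in>UNIV. sigma P m * (bvec P $ m + sqrt (2 * c))) / l"
  have "norm X \<le> b" if X: "X \<in> psd_mats" and c: "ffun P X \<le> c" for X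
  proof -
    have "0 \<le> mu P * (Rmat P \<bullet> X)"
      using P X by (simp add: valid_problem_def psd_inner_nonneg)
    then have n: "norm (meas P X - bvec P) \<le> sqrt (2 * c)"
      using c by (intro real_le_rsqrt) (simp add: ffun_def)
    have "Kmat P m \<bullet> X \<le> sigma P m * (bvec P $ m + sqrt (2 * c))" for m
    proof -
      have "(meas P X - bvec P) $ m \<le> sqrt (2 * c)"
        using component_le_norm_cart[of "meas P X - bvec P" m] n by linarith
      then show ?thesis
        using P by (simp add: meas_eq_inner valid_problem_def field_simps)
    qed
    then have TX: "T \<bullet> X \<le> l * b"
      using l(1) by (simp add: T_def b_def inner_sum_left sum_mono)
    obtain u :: "'n \<Rightarrow> complex^'n" where u: "X = (\<Sum>i\<in>UNIV. outer (u i) (u i))"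
      using X by (rule psd_eq_sum_outer)
    have "l * norm X \<le> l * (\<Sum>i\<in>UNIV. (norm (u i))\<^sup>2)"
      unfolding u using l(1) by (intro mult_left_mono norm_sum_outer_le) auto
    also have "\<dots> \<le> T \<bullet> X"
      unfolding u inner_sum_right inner_outer sum_distrib_left by (intro sum_mono l)
    finally show ?thesis using TX l(1) by (meson mult_le_cancel_left_pos order_trans)
  qed
  with that show thesis by blast
qed

text \<open>Points of the face with the measurements of \<open>Xs\<close> have the optimal value, so
  growth towards them is growth towards minimizers. The constant doubles because the quadratic term
  of the gap carries a factor 1/2.\<close>

lemma minimizers_quadratic_growth:
  fixes P :: "('n::finite, 'm::finite) sdp_problem"
  assumes P: "valid_problem P"
    and K: "\<And>m. Kmat P m = Khat m ** ctranspose (Khat m)"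
    and rank: "rank (stack_ct Khat) = CARD('n)"
    and Xs: "Xs \<in> minimizers P"
    and ri: "- grad_f P Xs \<in> rel_interior (normal_cone_psd Xs)"
  obtains a where "a > 0" "\<And>X. X \<in> psd_mats \<Longrightarrow> ffun P X \<le> c \<Longrightarrow>
    \<exists>W\<in>minimizers P. (norm (X - W))\<^sup>2 \<le> a * (ffun P X - ffun P W)"
proof -
  define S where "S = grad_f P Xs"
  have Xsp: "Xs \<in> psd_mats" and min: "\<And>Y. Y \<in> psd_mats \<Longrightarrow> ffun P Xs \<le> ffun P Y"
    using Xs by (auto simp: minimizers_iff)
  note sc = strict_complementarity[OF Xsp ri, folded S_def]
  have SXs: "S \<bullet> Xs = 0" using sc(2) by (simp add: psd_face_def)
  obtain b where b: "\<And>X. X \<in> psd_mats \<Longrightarrow> ffun P X \<le> c \<Longrightarrow> norm X \<le> b"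
    using sublevel_bounded[OF P K rank] by blast
  obtain a where a: "a > 0" and growth:
    "\<And>X. X \<in> psd_mats \<Longrightarrow> norm X \<le> b \<Longrightarrow> \<exists>W\<in>psd_face S. meas P W = meas P Xs \<and>
       (norm (X - W))\<^sup>2 \<le> a * ((norm (meas P (X - Xs)))\<^sup>2 + S \<bullet> X)"
    using psd_face_quadratic_growth[OF linear_meas sc] by blast
  have f: "ffun P X = ffun P Xs + S \<bullet> X + (norm (meas P (X - Xs)))\<^sup>2 / 2" for X
    using ffun_expand[of P X Xs] SXs by (simp add: S_def inner_diff_right)
  have "0 < 2 * a" using a by simp
  moreover have "\<exists>W\<in>minimizers P. (norm (X - W))\<^sup>2 \<le> (2 * a) * (ffun P X - ffun P W)"
    if X: "X \<in> psd_mats" "ffun P X \<le> c" for X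
  proof -
    obtain W where W: "W \<in> psd_face S" "meas P W = meas P Xs"
      "(norm (X - W))\<^sup>2 \<le> a * ((norm (meas P (X - Xs)))\<^sup>2 + S \<bullet> X)"
      using growth[OF X(1) b[OF X]] by blast
    have fW: "ffun P W = ffun P Xs"
      using W(1,2) by (simp add: f[of W] psd_face_def linear_diff[OF linear_meas])
    with W(1) min have "W \<in> minimizers P"
      by (simp add: minimizers_iff psd_face_def)
    moreover have "(norm (meas P (X - Xs)))\<^sup>2 + S \<bullet> X \<le> 2 * (ffun P X - ffun P W)"
      using psd_inner_nonneg[OF sc(1) X(1)] by (simp add: fW f[of X])
    then have "(norm (X - W))\<^sup>2 \<le> a * (2 * (ffun P X - ffun P W))"
      using W(3) a by (meson less_imp_le mult_left_mono order_trans)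
    ultimately show ?thesis by (auto simp: mult_ac)
  qed
  ultimately show thesis by (rule that)
qed

section \<open>Executions of the algorithm\<close>

lemma step_size_bounds:
  assumes "valid_params C" "step_size P C s \<alpha>"
  shows "0 < amin C" "amin C \<le> \<alpha>" "\<alpha> \<le> amax C"
  using assms by (auto simp: valid_params_def step_size_def)

text \<open>The first entry comes from condition (B), the second from condition (A) with the largest
  step size.\<close>

definition decrease_const :: "apg_params \<Rightarrow> real" where
  "decrease_const C = min (del C) (gam C / amax C)"

lemma decrease_const_pos: "valid_params C \<Longrightarrow> 0 < decrease_const C"
  by (auto simp: decrease_const_def valid_params_def)

text \<open>When the two points coincide, (B) compares finite values; otherwise acceptance includes
  (A).\<close>

lemma accepted_step_decrease:
  fixes s :: "'n::finite apg_state"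
  assumes C: "valid_params C" and X: "curX s \<in> psd_mats" and \<alpha>: "step_size P C s \<alpha>"
    and acc: "accepts P C s \<alpha>" and B: "curY s = curX s \<Longrightarrow> condB P C s \<alpha>"
    and Z: "Z = prox_step P (curY s) \<alpha>"
  shows "decrease_const C * (norm (curX s - Z))\<^sup>2 \<le> ffun P (curX s) - ffun P Z"
proof (cases "curY s = curX s")
  case True
  have "Z \<in> psd_mats"
    using step_size_bounds[OF C \<alpha>] prox_step_psd unfolding Z by (metis order_less_le_trans)
  then have "del C * (norm (curX s - Z))\<^sup>2 \<le> ffun P (curX s) - ffun P Z"
    using B[OF True] X by (simp add: condB_def Let_def True hfun_psd flip: Z[unfolded True])
  moreover have "decrease_const C * (norm (curX s - Z))\<^sup>2 \<le> del C * (norm (curX s - Z))\<^sup>2"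
    by (intro mult_right_mono) (auto simp: decrease_const_def)
  ultimately show ?thesis by linarith
next
  case False
  then have A: "condA P C s \<alpha>" using acc by (auto simp: accepts_def)
  have \<alpha>0: "0 < \<alpha>" "\<alpha> \<le> amax C" using step_size_bounds[OF C \<alpha>] by auto
  have "decrease_const C \<le> gam C / \<alpha>"
  proof -
    have "gam C / amax C \<le> gam C / \<alpha>"
      using C \<alpha>0 by (intro divide_left_mono) (auto simp: valid_params_def)
    then show ?thesis by (simp add: decrease_const_def)
  qed
  then have "decrease_const C * (norm (curX s - Z))\<^sup>2 \<le> gam C / \<alpha> * (norm (curX s - Z))\<^sup>2"
    by (intro mult_right_mono) auto
  also have "\<dots> \<le> ffun P (curX s) - ffun P Z"
    using A by (intro prox_step_descent[OF \<alpha>0(1) X _ Z]) (simp add: condA_def Let_def Z)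
  finally show ?thesis .
qed

section \<open>Sequences with geometrically decaying steps\<close>

lemma norm_diff_le_geometric:
  fixes x :: "nat \<Rightarrow> 'a::real_normed_vector"
  assumes step: "\<And>k. k \<ge> m \<Longrightarrow> norm (x (Suc k) - x k) \<le> c * v ^ k"
    and v: "0 < v" "v < 1" and c: "0 \<le> c" and "m \<le> k" "k \<le> n"
  shows "norm (x n - x k) \<le> c / (1 - v) * v ^ k"
proof -
  \<comment> \<open>Keeping the negative term v^n makes the induction telescope.\<close>
  have "norm (x n - x k) \<le> c / (1 - v) * (v ^ k - v ^ n)"
    using \<open>k \<le> n\<close>
  proof (induction n rule: dec_induct)
    case (step n)
    have "norm (x (Suc n) - x k) \<le> norm (x (Suc n) - x n) + norm (x n - x k)"
      using norm_triangle_ineq[of "x (Suc n) - x n" "x n - x k"] by simp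
    also have "\<dots> \<le> c * v ^ n + c / (1 - v) * (v ^ k - v ^ n)"
      using step \<open>m \<le> k\<close> assms(1)[of n] by simp
    also have "\<dots> = c / (1 - v) * (v ^ k - v ^ Suc n)"
      using v by (simp add: field_simps)
    finally show ?case .
  qed simp
  also have "\<dots> \<le> c / (1 - v) * v ^ k"
    using v c by (intro mult_left_mono) auto
  finally show ?thesis .
qed

lemma geometric_steps_limit:
  fixes x :: "nat \<Rightarrow> 'a::banach"
  assumes step: "\<And>k. k \<ge> m \<Longrightarrow> norm (x (Suc k) - x k) \<le> c * v ^ k"
    and v: "0 < v" "v < 1" and c: "0 \<le> c"
  obtains l where "x \<longlonglongrightarrow> l" "\<And>k. k \<ge> m \<Longrightarrow> norm (x k - l) \<le> c / (1 - v) * v ^ k"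
proof -
  have "(\<lambda>k. c / (1 - v) * v ^ k) \<longlonglongrightarrow> c / (1 - v) * 0"
    using v by (intro tendsto_mult_left LIMSEQ_power_zero) auto
  have "Cauchy x"
  proof (rule CauchyI')
    fix e :: real assume "0 < e"
    then have "\<forall>\<^sub>F k in sequentially. c / (1 - v) * v ^ k < e"
      using \<open>(\<lambda>k. c / (1 - v) * v ^ k) \<longlonglongrightarrow> c / (1 - v) * 0\<close> by (auto dest: order_tendstoD)
    then obtain N where N: "\<And>k. k \<ge> N \<Longrightarrow> c / (1 - v) * v ^ k < e"
      by (auto simp: eventually_sequentially)
    have "dist (x k) (x n) < e" if "k \<ge> max m N" "n > k" for k n
    proof -
      have "norm (x n - x k) \<le> c / (1 - v) * v ^ k"
        using that by (intro norm_diff_le_geometric[OF step v c]) auto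
      also have "\<dots> < e" using that by (intro N) simp
      finally show ?thesis by (simp add: dist_norm norm_minus_commute)
    qed
    then show "\<exists>M. \<forall>k\<ge>M. \<forall>n>k. dist (x k) (x n) < e" by blast
  qed
  then obtain l where l: "x \<longlonglongrightarrow> l"
    using Cauchy_convergent convergent_def by blast
  have "norm (x k - l) \<le> c / (1 - v) * v ^ k" if "k \<ge> m" for k
  proof (rule Lim_bounded)
    show "(\<lambda>n. norm (x k - x n)) \<longlonglongrightarrow> norm (x k - l)"
      by (intro tendsto_intros l)
    show "\<forall>n\<ge>k. norm (x k - x n) \<le> c / (1 - v) * v ^ k"
    proof (intro allI impI)
      fix n assume "k \<le> n"
      with that show "norm (x k - x n) \<le> c / (1 - v) * v ^ k"
        by (subst norm_minus_commute) (intro norm_diff_le_geometric[OF step v c])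
    qed
  qed
  with l show thesis by (rule that)
qed

section \<open>Passes of the loop and decay of the gap\<close>

locale apg_execution =
  fixes P :: "('n::finite, 'm::finite) sdp_problem" and C :: apg_params
    and X0 :: "complex^'n^'n" and s :: "nat \<Rightarrow> 'n apg_state" and \<alpha> :: "nat \<Rightarrow> real"
  assumes params: "valid_params C" and X0: "X0 \<in> psd_mats"
    and run: "apg_run P C X0 s \<alpha>" and B: "accepted_steps_decrease P C s \<alpha>"
begin

abbreviation "accepted j \<equiv> accepts P C (s j) (\<alpha> j)"

lemma s_0: "s 0 = init_state X0"
  using run by (simp add: apg_run_def)

lemma step: "step_size P C (s j) (\<alpha> j)"
  using run by (simp add: apg_run_def)

lemma s_Suc: "s (Suc j) = (if accepted j then advance P (s j) (\<alpha> j) else restart (s j))"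
  using run by (simp add: apg_run_def)

lemma curX_Suc:
  "curX (s (Suc j)) = (if accepted j then prox_step P (curY (s j)) (\<alpha> j) else curX (s j))"
  by (simp add: s_Suc advance_def restart_def Let_def)

lemma cnt_Suc: "cnt (s (Suc j)) = (if accepted j then Suc (cnt (s j)) else cnt (s j))"
  by (simp add: s_Suc advance_def restart_def Let_def)

lemma kres_Suc: "kres (s (Suc j)) = (if accepted j then kres (s j) else cnt (s j))"
  by (simp add: s_Suc advance_def restart_def Let_def)

lemma curX_psd: "curX (s j) \<in> psd_mats"
proof (induction j)
  case (Suc j)
  then show ?case
    using step_size_bounds[OF params step[of j]] by (auto simp: curX_Suc intro!: prox_step_psd)
qed (simp add: s_0 init_state_def X0)

lemma decrease:
  assumes "accepted j"
  shows "decrease_const C * (norm (curX (s j) - curX (s (Suc j))))\<^sup>2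
    \<le> ffun P (curX (s j)) - ffun P (curX (s (Suc j)))"
  using assms B by (intro accepted_step_decrease[OF params curX_psd step])
    (auto simp: curX_Suc accepted_steps_decrease_def)

lemma ffun_curX_Suc_le: "ffun P (curX (s (Suc j))) \<le> ffun P (curX (s j))"
proof (cases "accepted j")
  case True
  have "0 \<le> decrease_const C * (norm (curX (s j) - curX (s (Suc j))))\<^sup>2"
    using decrease_const_pos[OF params] by simp
  with decrease[OF True] show ?thesis by linarith
qed (simp add: curX_Suc)

lemma ffun_curX_le: "ffun P (curX (s j)) \<le> ffun P X0"
  using ffun_curX_Suc_le by (induction j) (auto simp: s_0 init_state_def intro: order_trans)

text \<open>A rejected pass restarts with equal points and \<open>kres\<close> equal to
  \<open>cnt\<close>, so the next pass is accepted whatever its step size.\<close>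

lemma accepted_with_same_cnt: "\<exists>i. cnt (s i) = cnt (s j) \<and> accepted i"
proof (cases "accepted j")
  case False
  then have "accepted (Suc j)"
    unfolding s_Suc accepts_def[of P C "if accepted j then _ else _"] by (simp add: restart_def)
  moreover have "cnt (s (Suc j)) = cnt (s j)" using False by (simp add: cnt_Suc)
  ultimately show ?thesis by blast
qed blast

text \<open>This translates statements about passes into statements about iteration numbers, which
  start at 1.\<close>

lemma cnt_attained: "k \<ge> 1 \<Longrightarrow> \<exists>j. cnt (s j) = k \<and> accepted j"
proof (induction k rule: nat_induct_at_least)
  case base
  show ?case using accepted_with_same_cnt[of 0] by (simp add: s_0 init_state_def)
next
  case (Suc k)
  then obtain j where "cnt (s j) = k" "accepted j" by blast
  then have "cnt (s (Suc j)) = Suc k" by (simp add: cnt_Suc)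
  then show ?case using accepted_with_same_cnt[of "Suc j"] by simp
qed

text \<open>
  A proximal gradient step from a restarted state contracts the gap by \<open>\<theta> = q / (1 + q)\<close>, and
  restarts are at most \<open>kmaxres C + 1\<close> iterations apart.  Hence, with \<open>w\<close> the corresponding root
  of \<open>\<theta>\<close>, the invariant below lags behind \<open>w ^ cnt\<close> only by the iterations since the last restart.
\<close>

lemma gap_linear_decay:
  assumes min: "\<And>j. fmin \<le> ffun P (curX (s j))"
    and Q: "Q > 0" and residual: "\<And>j. accepted j \<Longrightarrow> curY (s j) = curX (s j) \<Longrightarrow>
      ffun P (curX (s (Suc j))) - fmin \<le> Q * (norm (curX (s j) - curX (s (Suc j))))\<^sup>2"
  obtains c w where "c > 0" "0 < w" "w < 1"
    "\<And>j. ffun P (curX (s j)) - fmin \<le> c * w ^ cnt (s j)"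
proof -
  define gap where "gap j = ffun P (curX (s j)) - fmin" for j
  define q where "q = Q / decrease_const C"
  have q: "q > 0" using Q decrease_const_pos[OF params] by (simp add: q_def)
  define \<theta> where "\<theta> = q / (1 + q)"
  have \<theta>: "0 < \<theta>" "\<theta> < 1" using q by (auto simp: \<theta>_def)
  \<comment> \<open>The last pass accepted before a forced restart has distance
    \<open>kmaxres C\<close> from it and raises the counter once more.\<close>
  define r where "r = kmaxres C + 1"
  define w where "w = root r \<theta>"
  have w: "0 < w" "w < 1"
    using \<theta> by (auto simp: w_def r_def)
  have wr: "w ^ r = \<theta>"
    unfolding w_def using \<theta> by (intro real_root_pow_pos2) (auto simp: r_def)
  have contract: "gap (Suc j) \<le> \<theta> * gap j" if "accepted j" "curY (s j) = curX (s j)" for j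
  proof -
    have "gap (Suc j) \<le> q * (decrease_const C * (norm (curX (s j) - curX (s (Suc j))))\<^sup>2)"
      using residual[OF that] decrease_const_pos[OF params] by (simp add: gap_def q_def)
    also have "\<dots> \<le> q * (gap j - gap (Suc j))"
      using decrease[OF that(1)] q by (intro mult_left_mono) (auto simp: gap_def)
    finally show ?thesis using q by (simp add: \<theta>_def field_simps)
  qed
  \<comment> \<open>The run starts with counter 1 and last restart 0, so the invariant initially
    asks for the level w^r; adding 1 keeps \<open>c\<close> positive.\<close>
  define c where "c = (gap 0 + 1) / w ^ r"
  have gap0: "gap 0 \<ge> 0" using min by (simp add: gap_def)
  have c: "c > 0" using gap0 w by (simp add: c_def)
  have inv: "kres (s j) \<le> cnt (s j) \<and> cnt (s j) \<le> kres (s j) + r \<and>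
    (if cnt (s j) = kres (s j) then curY (s j) = curX (s j) \<and> gap j \<le> c * w ^ cnt (s j)
     else gap j \<le> c * w ^ (kres (s j) + r))" for j
  proof (induction j)
    case 0
    then show ?case using w by (simp add: s_0 init_state_def r_def c_def)
  next
    case (Suc j)
    show ?case
    proof (cases "accepted j")
      case False
      have "gap (Suc j) = gap j" using False by (simp add: gap_def curX_Suc)
      moreover have "gap j \<le> c * w ^ cnt (s j)"
      proof (cases "cnt (s j) = kres (s j)")
        case True
        then show ?thesis using Suc by simp
      next
        case False
        have "gap j \<le> c * w ^ (kres (s j) + r)" using Suc False by simp
        \<comment> \<open>The bound already holds at the latest possible restart, hence at an
          earlier one, as \<open>w\<close> is below 1.\<close>
        also have "\<dots> \<le> c * w ^ cnt (s j)"
          using Suc w c by (intro mult_left_mono power_decreasing) auto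
        finally show ?thesis .
      qed
      moreover have "curY (s (Suc j)) = curX (s (Suc j))"
        using False by (simp add: s_Suc restart_def)
      ultimately show ?thesis using False by (simp add: cnt_Suc kres_Suc)
    next
      case True
      have "cnt (s j) - kres (s j) \<le> kmaxres C" using True by (simp add: accepts_def)
      \<comment> \<open>The first step after a restart gains the whole factor \<theta> = w^r; the
        later ones only keep the gap from increasing.\<close>
      moreover have "gap (Suc j) \<le> c * w ^ (kres (s j) + r)"
      proof (cases "cnt (s j) = kres (s j)")
        case True
        then have "gap (Suc j) \<le> \<theta> * (c * w ^ kres (s j))"
          using Suc contract[OF \<open>accepted j\<close>] \<theta> by (auto intro: order_trans mult_left_mono)
        then show ?thesis by (simp add: power_add wr mult_ac)
      next
        case False
        then show ?thesis
          using Suc ffun_curX_Suc_le[of j] by (simp add: gap_def)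
      qed
      ultimately show ?thesis using Suc True by (auto simp: cnt_Suc kres_Suc r_def)
    qed
  qed
  have "gap j \<le> c * w ^ cnt (s j)" for j
  proof (cases "cnt (s j) = kres (s j)")
    case True
    then show ?thesis using inv[of j] by simp
  next
    case False
    then have "gap j \<le> c * w ^ (kres (s j) + r)" using inv[of j] by simp
    also have "\<dots> \<le> c * w ^ cnt (s j)"
      using inv[of j] w c by (intro mult_left_mono power_decreasing) auto
    finally show ?thesis .
  qed
  with c w show thesis by (intro that[of c w]) (auto simp: gap_def)
qed

end

text \<open>The sequence converges linearly in all cases; finite termination needs no separate treatment.\<close>

theorem theorem4p3:
  fixes P :: "('n::finite, 'm::finite) sdp_problem"
    and C :: apg_params
    and X0 :: "complex^'n^'n"
    and s :: "nat \<Rightarrow> 'n apg_state"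
    and \<alpha> :: "nat \<Rightarrow> real"
    and X :: "nat \<Rightarrow> complex^'n^'n"
    and Khat :: "'m \<Rightarrow> complex^'n^'n"
  assumes "valid_problem P" and "valid_params C" and "X0 \<in> psd_mats"
    and "apg_run P C X0 s \<alpha>" and "apg_iterates X0 s X"
    and "accepted_steps_decrease P C s \<alpha>"
    and "\<And>m. Kmat P m = Khat m ** ctranspose (Khat m)"
    and "rank (stack_ct Khat) = CARD('n)"
    and "minimizers P \<noteq> {}"
    and "\<exists>Xs\<in>minimizers P. 0 \<in> (\<lambda>G. grad_f P Xs + G) ` rel_interior (normal_cone_psd Xs)"
  shows "\<exists>Xbar\<in>minimizers P.
      (\<exists>k0. \<forall>k\<ge>k0. X k = Xbar) \<or>
      (\<exists>c1 c2 w1 w2 :: real. \<exists>kl::nat.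
         c1 > 0 \<and> c2 > 0 \<and> w1 \<in> {0<..<1} \<and> w2 \<in> {0<..<1} \<and> kl > 0 \<and>
         (\<forall>k>kl. hfun P (X k) - hfun P Xbar \<le> ereal (c1 * w1 ^ k) \<and>
                 norm (X k - Xbar) \<le> c2 * w2 ^ k))"
proof -
  interpret apg_execution P C X0 s \<alpha>
    using assms(2,3,4,6) by unfold_locales
  have X: "X (cnt (s j)) = curX (s j)" for j
    using assms(5) by (simp add: apg_iterates_def)
  obtain Xs where Xs: "Xs \<in> minimizers P"
    and ri: "- grad_f P Xs \<in> rel_interior (normal_cone_psd Xs)"
    using assms(10) by (auto simp: eq_neg_iff_add_eq_0[symmetric] minus_equation_iff add.commute
        dest!: minus_unique)
  have min: "ffun P Xs \<le> ffun P Y" if "Y \<in> psd_mats" for Y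
    using Xs that by (simp add: minimizers_iff)
  have fmin: "ffun P W = ffun P Xs" if "W \<in> minimizers P" for W
    using that Xs by (meson antisym minimizers_iff)
  obtain a where a: "a > 0" and growth: "\<And>X. X \<in> psd_mats \<Longrightarrow> ffun P X \<le> ffun P X0 \<Longrightarrow>
      \<exists>W\<in>minimizers P. (norm (X - W))\<^sup>2 \<le> a * (ffun P X - ffun P W)"
    using minimizers_quadratic_growth[OF assms(1,7,8) Xs ri] by blast
  obtain Lf where Lf: "Lf > 0" "\<And>D. norm (meas P D) \<le> Lf * norm D"
    using linear_bounded_pos[OF linear_meas] by blast
  define Q where "Q = a * (1 / amin C + Lf\<^sup>2)\<^sup>2"
  have amin: "amin C > 0" using params by (simp add: valid_params_def)
  then have "1 / amin C + Lf\<^sup>2 > 0" by (simp add: add_pos_nonneg)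
  then have Q: "Q > 0" using a by (simp add: Q_def)
  have residual: "ffun P (curX (s (Suc j))) - ffun P Xs
      \<le> Q * (norm (curX (s j) - curX (s (Suc j))))\<^sup>2"
    if "accepted j" "curY (s j) = curX (s j)" for j
  proof -
    \<comment> \<open>Monotonicity keeps the new iterate in the initial sublevel set, where growth
      is available.\<close>
    obtain W where W: "W \<in> minimizers P" "(norm (curX (s (Suc j)) - W))\<^sup>2
        \<le> a * (ffun P (curX (s (Suc j))) - ffun P W)"
      using growth[OF curX_psd ffun_curX_le] by blast
    have "W \<in> psd_mats" using W(1) by (simp add: minimizers_iff)
    with prox_step_residual[OF amin step_size_bounds(2)[OF params step[of j]] this _ Lf(2) _ W(2),
        of "curX (s j)"] that a
    show ?thesis by (simp add: curX_Suc fmin[OF W(1)] Q_def)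
  qed
  obtain c w where c: "c > 0" and w: "0 < w" "w < 1"
    and decay: "\<And>j. ffun P (curX (s j)) - ffun P Xs \<le> c * w ^ cnt (s j)"
    using gap_linear_decay[OF min[OF curX_psd] Q residual] by blast
  have iter: "X k \<in> psd_mats" "ffun P (X k) - ffun P Xs \<le> c * w ^ k"
    "decrease_const C * (norm (X k - X (Suc k)))\<^sup>2 \<le> c * w ^ k" if "k \<ge> 1" for k
  proof -
    obtain j where j: "cnt (s j) = k" "accepted j"
      using cnt_attained[OF \<open>k \<ge> 1\<close>] by blast
    have Xk: "X k = curX (s j)" using X[of j] j by simp
    have XSk: "X (Suc k) = curX (s (Suc j))" using X[of "Suc j"] j by (simp add: cnt_Suc)
    show "X k \<in> psd_mats" by (simp add: Xk curX_psd)
    show gap: "ffun P (X k) - ffun P Xs \<le> c * w ^ k" using decay[of j] j by (simp add: Xk)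
    show "decrease_const C * (norm (X k - X (Suc k)))\<^sup>2 \<le> c * w ^ k"
      using decrease[OF j(2)] gap min[OF curX_psd[of "Suc j"]] by (simp add: Xk XSk)
  qed
  \<comment> \<open>The gap bounds the square of the step length, hence the square root of the
    rate.\<close>
  define v where "v = sqrt w"
  have v: "0 < v" "v < 1" using w by (auto simp: v_def)
  define d where "d = sqrt (c / decrease_const C)"
  have d: "d > 0" using c decrease_const_pos[OF params] by (simp add: d_def)
  have "norm (X (Suc k) - X k) \<le> d * v ^ k" if "k \<ge> 1" for k
  proof -
    have "(norm (X (Suc k) - X k))\<^sup>2 \<le> c / decrease_const C * w ^ k"
      using iter(3)[OF that] decrease_const_pos[OF params]
      by (simp add: field_simps norm_minus_commute)
    then have "norm (X (Suc k) - X k) \<le> sqrt (c / decrease_const C * w ^ k)"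
      by (rule real_le_rsqrt)
    also have "\<dots> = d * v ^ k" by (simp only: d_def v_def real_sqrt_mult real_sqrt_power)
    finally show ?thesis .
  qed
  then obtain Xbar where lim: "X \<longlonglongrightarrow> Xbar"
    and rate: "\<And>k. k \<ge> 1 \<Longrightarrow> norm (X k - Xbar) \<le> d / (1 - v) * v ^ k"
    using geometric_steps_limit[OF _ v, of 1 X d] d by (metis less_imp_le)
  have Xbar: "Xbar \<in> psd_mats"
    using iter(1) by (intro Lim_in_closed_set[OF closed_psd _ _ lim])
      (auto intro!: eventually_sequentiallyI[of 1])
  have "(\<lambda>k. ffun P (X k)) \<longlonglongrightarrow> ffun P Xbar"
    using continuous_on_tendsto_compose[OF continuous_on_ffun[of UNIV P] lim] by simp
  \<comment> \<open>The gap tends to 0, so by continuity the limit attains the optimal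
    value.\<close>
  then have "ffun P Xbar - ffun P Xs \<le> 0"
  proof (rule LIMSEQ_le[OF tendsto_diff[OF _ tendsto_const]])
    show "(\<lambda>k. c * w ^ k) \<longlonglongrightarrow> 0"
      using w by (intro tendsto_mult_right_zero LIMSEQ_power_zero) auto
    show "\<exists>N. \<forall>k\<ge>N. ffun P (X k) - ffun P Xs \<le> c * w ^ k"
      using iter(2) by blast
  qed
  then have "ffun P Xbar \<le> ffun P Y" if "Y \<in> psd_mats" for Y
    using min[OF that] by linarith
  with Xbar have Xbar_min: "Xbar \<in> minimizers P"
    by (simp add: minimizers_iff)
  have "hfun P (X k) - hfun P Xbar \<le> ereal (c * w ^ k) \<and> norm (X k - Xbar) \<le> d / (1 - v) * v ^ k"
    if "k > 1" for k
    using iter(1,2)[of k] rate[of k] that by (simp add: hfun_psd Xbar fmin[OF Xbar_min])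
  moreover have "d / (1 - v) > 0" using d v by simp
  ultimately show ?thesis
    using c w v Xbar_min
    by (intro bexI[of _ Xbar] disjI2 exI[of _ c] exI[of _ "d / (1 - v)"] exI[of _ w] exI[of _ v]
        exI[of _ 1]) auto
qed

end
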